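(* Let $r_M>0$ and let $r:(0,\infty)\times[0,r_M]\to\mathbb{R}$ satisfy $0\le r(x,I)\le r_M$ for all $x>0$, $I\in[0,r_M]$, $\frac{\partial r}{\partial I}\in L^\infty((0,\infty)\times(0,r_M))$, and $\frac{\partial r}{\partial I}(x,I)\le 0$ for all $x>0$, $I\in[0,r_M]$. Assume there is a constant $r_0>0$ with $r(x,I)\ge r_0$ for all $x,I$. Let $n_{\rm ini}\in L^1(0,\infty)$ with $n_{\rm ini}\ge 0$ and $\int_0^\infty n_{\rm ini}(x)\,dx=1$. Then the solution $n$ of the nonlinear age-structured equation $$\begin{cases}\partial_t n(t,x)+\partial_x n(t,x)+r(x,I(t))\,n(t,x)=0, & t,x\ge 0,\\ I(t)=\int_0^\infty r(x,I(t))\,n(t,x)\,dx,\\ n(t,x=0)=I(t),\\ n(t=0)=n_{\rm ini},\end{cases}$$ converges exponentially fast to the unique steady state: the equation has a unique steady state $\overline n$ of mass $1$, and there are constants $C,\lambda>0$ such that $\|n(t)-\overline n\|_1\le C e^{-\lambda t}$ for all $t\ge0$.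
   Context: Notation: $\|u\|_1=\int_0^\infty|u(x)|\,dx$. A solution is a pair $(n,I)$ with $n\in C([0,\infty);L^1(0,\infty))$, $n\ge0$, $\int_0^\infty n(t,x)\,dx=1$ and $I:[0,\infty)\to[0,r_M]$ continuous, $I(t)=\int_0^\infty r(x,I(t))n(t,x)dx$, the transport equation being understood in the weak sense, i.e. by characteristics: $n(t,x)=n_{\rm ini}(x-t)\exp(-\int_0^t r(x-t+s,I(s))ds)$ for $x\ge t$ and $n(t,x)=I(t-x)\exp(-\int_0^x r(s,I(t-x+s))ds)$ for $x<t$. A steady state of mass $1$ is a pair $(\overline n,\overline I)$ with $\overline I\in[0,r_M]$, $\overline n\ge 0$, $\overline n'(x)+r(x,\overline I)\overline n(x)=0$, $\overline n(0)=\overline I=\int_0^\infty r(x,\overline I)\overline n(x)dx$, $\int_0^\infty\overline n\,dx=1$. *)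

theory Defs
  imports "HOL-Analysis.Analysis"
begin

text \<open>
  Lebesgue classes on \<open>(0,\<infinity>)\<close> are represented by functions \<open>real \<Rightarrow> real\<close>; only their values on
  \<open>{0<..}\<close> matter, and identities between classes are read almost everywhere.
\<close>

abbreviation half_line :: "real measure" where
  "half_line \<equiv> lebesgue_on {0<..}"

definition L1_norm :: "(real \<Rightarrow> real) \<Rightarrow> real" where
  "L1_norm u = (LINT x|half_line. \<bar>u x\<bar>)"

definition in_L_infinity :: "'a::euclidean_space set \<Rightarrow> ('a \<Rightarrow> real) \<Rightarrow> bool" where
  "in_L_infinity S f \<longleftrightarrow>
     f \<in> borel_measurable (lebesgue_on S) \<and> (\<exists>M. AE z in lebesgue_on S. \<bar>f z\<bar> \<le> M)"

definition absolutely_continuous_on :: "real \<Rightarrow> real \<Rightarrow> (real \<Rightarrow> real) \<Rightarrow> bool" where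
  "absolutely_continuous_on a b f \<longleftrightarrow>
     (\<forall>\<epsilon>>0. \<exists>\<delta>>0. \<forall>P :: (real \<times> real) set.
        finite P \<and> (\<forall>(u, v)\<in>P. a \<le> u \<and> u < v \<and> v \<le> b) \<and>
        disjoint_family_on (\<lambda>(u, v). {u<..<v}) P \<and> (\<Sum>(u, v)\<in>P. v - u) < \<delta>
        \<longrightarrow> (\<Sum>(u, v)\<in>P. \<bar>f v - f u\<bar>) < \<epsilon>)"

text \<open>
  The transport equation with its boundary and initial condition is understood along
  characteristics, for every \<open>t \<ge> 0\<close> and almost every \<open>x > 0\<close>; the fourth conjunct says
  \<open>n \<in> C([0,\<infinity>); L\<^sup>1(0,\<infinity>))\<close>. The integrands involve \<open>r\<close> at age \<open>0\<close> at most at one endpoint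
  of integration, a null set.
\<close>

definition is_solution ::
  "real \<Rightarrow> (real \<Rightarrow> real \<Rightarrow> real) \<Rightarrow> (real \<Rightarrow> real) \<Rightarrow> (real \<Rightarrow> real \<Rightarrow> real) \<Rightarrow> (real \<Rightarrow> real) \<Rightarrow> bool"
where
  "is_solution r\<^sub>M r n_ini n I \<longleftrightarrow>
     continuous_on {0..} I \<and>
     (\<forall>t\<ge>0. I t \<in> {0..r\<^sub>M}) \<and>
     (\<forall>t\<ge>0. integrable half_line (n t) \<and> (AE x in half_line. 0 \<le> n t x) \<and>
             (LINT x|half_line. n t x) = 1) \<and>
     (\<forall>t\<ge>0. ((\<lambda>s. L1_norm (\<lambda>x. n s x - n t x)) \<longlongrightarrow> 0) (at t within {0..})) \<and>
     (\<forall>t\<ge>0. I t = (LINT x|half_line. r x (I t) * n t x)) \<and>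
     (\<forall>t\<ge>0. AE x in half_line.
        n t x = (if t \<le> x
                 then n_ini (x - t) * exp (- (LINT s|lebesgue_on {0..t}. r (x - t + s) (I s)))
                 else I (t - x) * exp (- (LINT s|lebesgue_on {0..x}. r s (I (t - x + s))))))"

text \<open>
  As \<open>r\<close> is only measurable in age, \<open>\<nu>' + r(\<cdot>, J) \<nu> = 0\<close> is an ODE in the sense of
  Caratheodory: \<open>\<nu>\<close> is locally absolutely continuous on \<open>[0,\<infinity>)\<close> and the equation holds almost
  everywhere.
\<close>

definition is_steady_state ::
  "real \<Rightarrow> (real \<Rightarrow> real \<Rightarrow> real) \<Rightarrow> (real \<Rightarrow> real) \<Rightarrow> real \<Rightarrow> bool"
where
  "is_steady_state r\<^sub>M r \<nu> J \<longleftrightarrow>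
     J \<in> {0..r\<^sub>M} \<and>
     (\<forall>x\<ge>0. 0 \<le> \<nu> x) \<and>
     (\<forall>b>0. absolutely_continuous_on 0 b \<nu>) \<and>
     (AE x in half_line. \<exists>d. (\<nu> has_real_derivative d) (at x) \<and> d + r x J * \<nu> x = 0) \<and>
     \<nu> 0 = J \<and>
     J = (LINT x|half_line. r x J * \<nu> x) \<and>
     integrable half_line \<nu> \<and> (LINT x|half_line. \<nu> x) = 1"

end

theory Submission
  imports Defs
begin

text \<open>
  Write \<open>m = n(t) - \<nu>\<close> for the distance to the steady state \<open>(\<nu>, J)\<close>. Along the flow
    \<open>\<partial>\<^sub>t m + \<partial>\<^sub>x m + r(x, I) m = (r(x, J) - r(x, I)) \<nu>\<close>, with \<open>m(t, 0) = I - J\<close>,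
  so that
    \<open>d/dt \<parallel>m\<parallel> \<le> \<bar>I - J\<bar> + \<integral>\<bar>r(x, I) - r(x, J)\<bar> \<nu> - \<integral>r(x, I) \<bar>m\<bar>\<close>.
  The first two terms are the dangerous ones, and inhibition makes them collapse. Subtracting the
  equations that define \<open>I\<close> and \<open>J\<close> gives
    \<open>(I - J) + \<integral>(r(x, J) - r(x, I)) \<nu> = \<integral>r(x, I) m\<close>,
  and since \<open>r\<close> is nonincreasing in the activity, both terms on the left have the sign of \<open>I - J\<close> or
  vanish.
  Hence the two dangerous terms add up to \<open>\<bar>\<integral>r(x, I) m\<bar>\<close>. As \<open>m\<close> has integral \<open>0\<close>, this
  equals \<open>\<bar>\<integral>(r(x, I) - r\<^sub>0) m\<bar>\<close>, which is at most \<open>\<integral>(r(x, I) - r\<^sub>0) \<bar>m\<bar>\<close> because \<open>r \<ge> r\<^sub>0\<close>.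
  Therefore \<open>d/dt \<parallel>m\<parallel> \<le> - r\<^sub>0 \<parallel>m\<parallel>\<close>, and the rate of convergence is \<open>r\<^sub>0\<close>.

  Solutions are only given along characteristics, so the differential inequality is replaced by
  \<open>\<parallel>m(t + h)\<parallel> \<le> (1 - r\<^sub>0 h) \<parallel>m(t)\<parallel> + 4 r\<^sub>M\<^sup>2 h\<^sup>2\<close> (lemma \<open>one_step_contraction\<close>, with the
  cancellation above in \<open>inhibition_cancellation\<close>). Iterating over \<open>N\<close> steps of length \<open>t / N\<close> and
  letting \<open>N \<longlonglongrightarrow> \<infinity>\<close> yields \<open>\<parallel>m(t)\<parallel> \<le> e\<^bsup>-r\<^sub>0 t\<^esup> \<parallel>m(0)\<parallel>\<close>.

  A steady state is \<open>J\<close> times the survival function \<open>exp(- \<integral>\<^sub>0\<^sup>x r(s, J) ds)\<close>, and its mass is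
  \<open>J\<close> times the mean lifetime at activity \<open>J\<close>. The mean lifetime is continuous, nondecreasing in
  \<open>J\<close> and at least \<open>1 / r\<^sub>M\<close>, so exactly one \<open>J\<close> in \<open>[0, r\<^sub>M]\<close> gives mass \<open>1\<close>
  (\<open>equilibrium_activity\<close>). That the ODE has no other solutions is where absolute continuity
  enters (\<open>AC_zero_derivative_imp_const\<close>).

  As \<open>r\<close> is Lebesgue measurable in the age and continuous in the activity, it agrees off a null set
  of ages with a jointly Borel function \<open>\<rho>\<close> (\<open>Caratheodory_borel_version\<close>). All estimates are made
  for \<open>\<rho>\<close>, where Fubini's theorem applies on the Borel product.
\<close>

section \<open>Absolutely continuous functions\<close>

text \<open>
  The Henstock argument: a gauge keeps the intervals tagged in the exceptional null set inside an
  open set of small measure, where absolute continuity bounds their increments, while on the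
  remaining intervals the vanishing derivative at the tag bounds the increments by a small multiple
  of the length. The total increment telescopes over a fine tagged division.
\<close>

lemma AC_zero_derivative_imp_const:
  fixes f :: "real \<Rightarrow> real"
  assumes ab: "a \<le> b" and ac: "absolutely_continuous_on a b f"
    and der: "AE x in lebesgue. a < x \<and> x < b \<longrightarrow> (f has_real_derivative 0) (at x)"
  shows "f b = f a"
proof -
  obtain N0 where N0: "N0 \<in> null_sets lebesgue"
      "{x. \<not> (a < x \<and> x < b \<longrightarrow> (f has_real_derivative 0) (at x))} \<subseteq> N0"
    using der by (auto simp: eventually_ae_filter)
  define N where "N = insert a (insert b N0)"
  have N: "N \<in> null_sets lebesgue"
    unfolding N_def using N0(1) by (metis negligible_iff_null_sets negligible_insert)
  have dN: "(f has_real_derivative 0) (at x)" if "x \<in> {a..b}" "x \<notin> N" for x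
    using N0(2) that unfolding N_def by force
  have "\<bar>f b - f a\<bar> \<le> \<epsilon> * (1 + (b - a))" if e: "\<epsilon> > 0" for \<epsilon>
  proof -
    obtain \<delta> where d: "\<delta> > 0" and acd: "\<And>P :: (real \<times> real) set.
        finite P \<Longrightarrow> (\<forall>(u, v)\<in>P. a \<le> u \<and> u < v \<and> v \<le> b) \<Longrightarrow>
        disjoint_family_on (\<lambda>(u, v). {u<..<v}) P \<Longrightarrow> (\<Sum>(u, v)\<in>P. v - u) < \<delta>
        \<Longrightarrow> (\<Sum>(u, v)\<in>P. \<bar>f v - f u\<bar>) < \<epsilon>"
      using ac e unfolding absolutely_continuous_on_def by meson
    obtain T where T: "open T" "N \<subseteq> T" "T - N \<in> lmeasurable" "emeasure lebesgue (T - N) < ennreal \<delta>"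
      using sets_lebesgue_outer_open[of N \<delta>] N d by blast
    have eT: "emeasure lebesgue T < ennreal \<delta>"
    proof -
      have "emeasure lebesgue (T - N) = emeasure lebesgue T"
        using N T(1) by (intro emeasure_Diff_null_set) (auto)
      then show ?thesis using T(4) by simp
    qed
    have "\<exists>r>0. \<forall>y. \<bar>y - x\<bar> < r \<longrightarrow> \<bar>f y - f x\<bar> \<le> \<epsilon> * \<bar>y - x\<bar>" if "x \<in> {a..b}" "x \<notin> N" for x
    proof -
      have "(f has_derivative (\<lambda>h. 0)) (at x)"
        using dN[OF that] by (simp add: has_field_derivative_def lambda_zero)
      then show ?thesis
        using e unfolding has_derivative_at_alt by (auto simp: real_norm_def)
    qed
    then obtain r where r: "\<And>x. x \<in> {a..b} \<Longrightarrow> x \<notin> N \<Longrightarrow> r x > 0"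
      "\<And>x y. x \<in> {a..b} \<Longrightarrow> x \<notin> N \<Longrightarrow> \<bar>y - x\<bar> < r x \<Longrightarrow> \<bar>f y - f x\<bar> \<le> \<epsilon> * \<bar>y - x\<bar>"
      by metis
    define \<gamma> where "\<gamma> x = (if x \<in> N then T else if x \<in> {a..b} then ball x (r x) else UNIV)" for x
    have "gauge \<gamma>"
      unfolding gauge_def \<gamma>_def using T r(1) by auto
    then obtain p where p: "p tagged_division_of {a..b}" "\<gamma> fine p"
      by (rule fine_division_exists_real)
    note td = tagged_division_ofD[OF p(1)]
    have fin: "finite p" by (rule td(1))
    have shape: "\<exists>u v. k = {u..v} \<and> a \<le> u \<and> u \<le> v \<and> v \<le> b \<and> x \<in> {u..v}" if "(x, k) \<in> p" for x k
    proof -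
      obtain u v where "k = cbox u v" using td(4)[OF \<open>(x, k) \<in> p\<close>] by blast
      moreover have "x \<in> k" "k \<subseteq> {a..b}" using td(2,3)[OF \<open>(x, k) \<in> p\<close>] by auto
      ultimately show ?thesis by (intro exI[of _ u] exI[of _ v]) auto
    qed
    (* p1: nondegenerate pieces tagged in the null set; p2: pieces tagged at a point with derivative 0.
       Degenerate pieces have no increment. *)
    define D where "D = (\<lambda>(x::real, k). f (Sup k) - f (Inf k))"
    define p1 where "p1 = {z \<in> p. fst z \<in> N \<and> Inf (snd z) < Sup (snd z)}"
    define p2 where "p2 = {z \<in> p. fst z \<notin> N}"
    have fin12: "finite p1" "finite p2" using fin by (auto simp: p1_def p2_def)
    (* Forgetting the tag does not identify two pieces, since nondegenerate pieces are disjoint. *)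
    define J where "J = (\<lambda>z :: real \<times> real set. (Inf (snd z), Sup (snd z)))"
    have disj: "{Inf k<..<Sup k} \<inter> {Inf k'<..<Sup k'} = {}"
      if xk: "(x, k) \<in> p" "(x', k') \<in> p" "(x, k) \<noteq> (x', k')" for x k x' k'
    proof -
      have "interior k \<inter> interior k' = {}" by (rule td(5)[OF xk])
      moreover obtain u v where "k = {u..v}" "u \<le> v" using shape[OF xk(1)] by blast
      moreover obtain u' v' where "k' = {u'..v'}" "u' \<le> v'" using shape[OF xk(2)] by blast
      ultimately show ?thesis by (simp add: interior_atLeastAtMost_real)
    qed
    have inj: "inj_on J p1"
    proof (rule inj_onI)
      fix z z' assume z: "z \<in> p1" "z' \<in> p1" "J z = J z'"
      show "z = z'"
      proof (rule ccontr)
        assume "z \<noteq> z'"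
        then have "{Inf (snd z)<..<Sup (snd z)} \<inter> {Inf (snd z')<..<Sup (snd z')} = {}"
          using disj[of "fst z" "snd z" "fst z'" "snd z'"] z by (auto simp: p1_def)
        then show False using z by (auto simp: J_def p1_def)
      qed
    qed
    have sum1: "(\<Sum>z\<in>p1. \<bar>D z\<bar>) < \<epsilon>"
    proof -
      have "(\<Sum>(u, v)\<in>J ` p1. \<bar>f v - f u\<bar>) < \<epsilon>"
      proof (rule acd)
        show "finite (J ` p1)" using fin12 by simp
        show "\<forall>(u, v)\<in>J ` p1. a \<le> u \<and> u < v \<and> v \<le> b"
          using shape by (fastforce simp: p1_def J_def)
        show dj: "disjoint_family_on (\<lambda>(u, v). {u<..<v}) (J ` p1)"
          unfolding disjoint_family_on_def
        proof (intro ballI impI)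
          fix m n assume mn: "m \<in> J ` p1" "n \<in> J ` p1" "m \<noteq> n"
          then obtain z z' where "m = J z" "n = J z'" "z \<in> p1" "z' \<in> p1" "z \<noteq> z'" by auto
          then show "(case m of (u, v) \<Rightarrow> {u<..<v}) \<inter> (case n of (u, v) \<Rightarrow> {u<..<v}) = {}"
            using disj[of "fst z" "snd z" "fst z'" "snd z'"] by (auto simp: p1_def J_def)
        qed
        have "ennreal (\<Sum>(u, v)\<in>J ` p1. v - u) = (\<Sum>z\<in>J ` p1. ennreal (case z of (u, v) \<Rightarrow> v - u))"
          by (subst sum_ennreal) (auto simp: J_def p1_def)
        also have "\<dots> = (\<Sum>z\<in>J ` p1. emeasure lebesgue (case z of (u, v) \<Rightarrow> {u<..<v}))"
          by (intro sum.cong) (auto simp: J_def p1_def)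
        also have "\<dots> = emeasure lebesgue (\<Union>z\<in>J ` p1. case z of (u, v) \<Rightarrow> {u<..<v})"
          using fin12 dj by (intro sum_emeasure) auto
        also have "\<dots> \<le> emeasure lebesgue T"
        proof (rule emeasure_mono)
          show "(\<Union>z\<in>J ` p1. case z of (u, v) \<Rightarrow> {u<..<v}) \<subseteq> T"
          proof
            fix y assume "y \<in> (\<Union>z\<in>J ` p1. case z of (u, v) \<Rightarrow> {u<..<v})"
            then obtain u v where z: "(u, v) \<in> p1" and y: "y \<in> {Inf v<..<Sup v}"
              by (auto simp: J_def)
            then have "(u, v) \<in> p" "u \<in> N" by (auto simp: p1_def)
            then have "v \<subseteq> T" using p(2) unfolding fine_def \<gamma>_def by (force split: if_splits)
            moreover have "y \<in> v" using y shape[OF \<open>(u, v) \<in> p\<close>] by (auto simp: J_def)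
            ultimately show "y \<in> T" by blast
          qed
        qed (use T(1) in auto)
        also have "\<dots> < ennreal \<delta>" by (rule eT)
        finally have lt: "ennreal (\<Sum>(u, v)\<in>J ` p1. v - u) < ennreal \<delta>" .
        show "(\<Sum>(u, v)\<in>J ` p1. v - u) < \<delta>"
        proof (rule ccontr)
          assume "\<not> (\<Sum>(u, v)\<in>J ` p1. v - u) < \<delta>"
          then have "ennreal \<delta> \<le> ennreal (\<Sum>(u, v)\<in>J ` p1. v - u)" by (intro ennreal_leI) simp
          then show False using lt by simp
        qed
      qed
      also have "(\<Sum>(u, v)\<in>J ` p1. \<bar>f v - f u\<bar>) = (\<Sum>z\<in>p1. \<bar>D z\<bar>)"
        by (subst sum.reindex[OF inj]) (auto simp: J_def D_def intro!: sum.cong)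
      finally show ?thesis .
    qed
    have sum2: "(\<Sum>z\<in>p2. \<bar>D z\<bar>) \<le> \<epsilon> * (b - a)"
    proof -
      have "(\<Sum>z\<in>p2. \<bar>D z\<bar>) \<le> (\<Sum>z\<in>p2. \<epsilon> * (Sup (snd z) - Inf (snd z)))"
      proof (rule sum_mono)
        fix z assume z: "z \<in> p2"
        obtain x k where xk: "z = (x, k)" by (cases z)
        then have k: "(x, k) \<in> p" "x \<notin> N" using z by (auto simp: p2_def)
        obtain u v where uv: "k = {u..v}" "a \<le> u" "u \<le> v" "v \<le> b" "x \<in> {u..v}"
          using shape[OF k(1)] by blast
        have x: "x \<in> {a..b}" using uv by auto
        then have "k \<subseteq> ball x (r x)" using p(2) k unfolding fine_def \<gamma>_def by (fastforce split: if_splits)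
        moreover have "u \<in> k" "v \<in> k" using uv by auto
        ultimately have "u \<in> ball x (r x)" "v \<in> ball x (r x)" by blast+
        then have "\<bar>u - x\<bar> < r x" "\<bar>v - x\<bar> < r x" by (auto simp: dist_real_def abs_minus_commute)
        then have "\<bar>f u - f x\<bar> \<le> \<epsilon> * \<bar>u - x\<bar>" "\<bar>f v - f x\<bar> \<le> \<epsilon> * \<bar>v - x\<bar>"
          using r(2)[OF x k(2)] by auto
        moreover have "\<epsilon> * \<bar>u - x\<bar> + \<epsilon> * \<bar>v - x\<bar> = \<epsilon> * (v - u)"
          using uv by (simp add: algebra_simps)
        ultimately have "\<bar>f v - f u\<bar> \<le> \<epsilon> * (v - u)" by linarith
        then show "\<bar>D z\<bar> \<le> \<epsilon> * (Sup (snd z) - Inf (snd z))"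
          using uv xk by (simp add: D_def)
      qed
      also have "\<dots> \<le> (\<Sum>z\<in>p. \<epsilon> * (Sup (snd z) - Inf (snd z)))"
        using fin e shape by (intro sum_mono2) (fastforce simp: p2_def)+
      also have "\<dots> = \<epsilon> * (\<Sum>(x, k)\<in>p. Sup k - Inf k)"
        by (simp add: sum_distrib_left case_prod_beta)
      also have "(\<Sum>(x, k)\<in>p. Sup k - Inf k) = b - a"
        using additive_tagged_division_1[OF ab p(1), of "\<lambda>x. x"] by simp
      finally show ?thesis .
    qed
    have "f b - f a = (\<Sum>z\<in>p. D z)"
      using additive_tagged_division_1[OF ab p(1), of f] by (simp add: D_def)
    also have "\<dots> = (\<Sum>z\<in>p1 \<union> p2. D z)"
    proof (rule sum.mono_neutral_right[OF fin])
      show "p1 \<union> p2 \<subseteq> p" by (auto simp: p1_def p2_def)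
      show "\<forall>z\<in>p - (p1 \<union> p2). D z = 0"
      proof
        fix z assume z: "z \<in> p - (p1 \<union> p2)"
        obtain x k where xk: "z = (x, k)" by (cases z)
        then obtain u v where "k = {u..v}" "u \<le> v" using shape[of x k] z by blast
        then show "D z = 0" using z xk by (auto simp: p1_def p2_def D_def)
      qed
    qed
    also have "\<dots> = (\<Sum>z\<in>p1. D z) + (\<Sum>z\<in>p2. D z)"
      using fin12 by (intro sum.union_disjoint) (auto simp: p1_def p2_def)
    finally have "\<bar>f b - f a\<bar> \<le> (\<Sum>z\<in>p1. \<bar>D z\<bar>) + (\<Sum>z\<in>p2. \<bar>D z\<bar>)"
      using sum_abs[of D p1] sum_abs[of D p2] by linarith
    then show ?thesis using sum1 sum2 by (simp add: algebra_simps)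
  qed
  then have *: "\<bar>f b - f a\<bar> \<le> \<epsilon> * (1 + (b - a))" if "\<epsilon> > 0" for \<epsilon>
    using that by blast
  have "\<bar>f b - f a\<bar> \<le> 0"
  proof (rule field_le_epsilon)
    fix e :: real assume "e > 0"
    then show "\<bar>f b - f a\<bar> \<le> 0 + e"
      using *[of "e / (1 + (b - a))"] ab by simp
  qed
  then show ?thesis by simp
qed

lemma Lipschitz_imp_AC:
  fixes f :: "real \<Rightarrow> real"
  assumes L: "\<And>x y. a \<le> x \<Longrightarrow> x \<le> y \<Longrightarrow> y \<le> b \<Longrightarrow> \<bar>f y - f x\<bar> \<le> L * (y - x)"
  shows "absolutely_continuous_on a b f"
  unfolding absolutely_continuous_on_def
proof (intro allI impI)
  fix e :: real assume e: "e > 0"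
  define L' where "L' = \<bar>L\<bar> + 1"
  have L': "L' > 0" "L \<le> L'" by (auto simp: L'_def)
  have "(\<Sum>(u, v)\<in>P. \<bar>f v - f u\<bar>) < e"
    if P: "\<forall>(u, v)\<in>P. a \<le> u \<and> u < v \<and> v \<le> b" "(\<Sum>(u, v)\<in>P. v - u) < e / L'"
    for P :: "(real \<times> real) set"
  proof -
    have "\<bar>f v - f u\<bar> \<le> L' * (v - u)" if "(u, v) \<in> P" for u v
    proof -
      have "a \<le> u" "u < v" "v \<le> b" using P(1) that by auto
      then show ?thesis using L[of u v] mult_right_mono[OF L'(2), of "v - u"] by linarith
    qed
    then have "(\<Sum>(u, v)\<in>P. \<bar>f v - f u\<bar>) \<le> (\<Sum>(u, v)\<in>P. L' * (v - u))"
      by (intro sum_mono) auto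
    also have "\<dots> = L' * (\<Sum>(u, v)\<in>P. v - u)"
      by (simp add: sum_distrib_left case_prod_beta)
    also have "\<dots> < L' * (e / L')"
      using P(2) L'(1) by (rule mult_strict_left_mono)
    finally show ?thesis using L'(1) by simp
  qed
  then show "\<exists>d>0. \<forall>P :: (real \<times> real) set.
        finite P \<and> (\<forall>(u, v)\<in>P. a \<le> u \<and> u < v \<and> v \<le> b) \<and>
        disjoint_family_on (\<lambda>(u, v). {u<..<v}) P \<and> (\<Sum>(u, v)\<in>P. v - u) < d
        \<longrightarrow> (\<Sum>(u, v)\<in>P. \<bar>f v - f u\<bar>) < e"
    using e L' by (intro exI[of _ "e / L'"]) auto
qed

lemma AC_imp_continuous_on:
  assumes "absolutely_continuous_on a b f"
  shows "continuous_on {a..b} f"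
  unfolding continuous_on_iff
proof (intro ballI allI impI)
  fix x e :: real assume x: "x \<in> {a..b}" and e: "e > 0"
  obtain d where d: "d > 0" and P: "\<And>P :: (real \<times> real) set.
        finite P \<and> (\<forall>(u, v)\<in>P. a \<le> u \<and> u < v \<and> v \<le> b) \<and>
        disjoint_family_on (\<lambda>(u, v). {u<..<v}) P \<and> (\<Sum>(u, v)\<in>P. v - u) < d
        \<Longrightarrow> (\<Sum>(u, v)\<in>P. \<bar>f v - f u\<bar>) < e"
    using assms e unfolding absolutely_continuous_on_def by meson
  have *: "\<bar>f v - f u\<bar> < e" if "a \<le> u" "u < v" "v \<le> b" "v - u < d" for u v
    using P[of "{(u, v)}"] that by (simp add: disjoint_family_on_def)
  have "dist (f y) (f x) < e" if "y \<in> {a..b}" "dist y x < d" for y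
    using *[of x y] *[of y x] x that e
    by (cases x y rule: linorder_cases) (simp_all add: dist_real_def abs_minus_commute)
  then show "\<exists>d>0. \<forall>y\<in>{a..b}. dist y x < d \<longrightarrow> dist (f y) (f x) < e"
    using d by blast
qed

lemma AC_mult:
  assumes f: "absolutely_continuous_on a b f" and g: "absolutely_continuous_on a b g"
  shows "absolutely_continuous_on a b (\<lambda>x. f x * g x)"
proof -
  have "bounded (f ` {a..b})" "bounded (g ` {a..b})"
    using f g by (auto intro!: compact_imp_bounded compact_continuous_image AC_imp_continuous_on)
  then obtain B1 B2 where B: "\<And>x. x \<in> {a..b} \<Longrightarrow> \<bar>f x\<bar> \<le> B1" "\<And>x. x \<in> {a..b} \<Longrightarrow> \<bar>g x\<bar> \<le> B2"
    unfolding bounded_iff by (metis image_eqI real_norm_def)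
  define M where "M = \<bar>B1\<bar> + \<bar>B2\<bar> + 1"
  have M: "M > 0" "\<And>x. x \<in> {a..b} \<Longrightarrow> \<bar>f x\<bar> \<le> M" "\<And>x. x \<in> {a..b} \<Longrightarrow> \<bar>g x\<bar> \<le> M"
    using B unfolding M_def by fastforce+
  show ?thesis
    unfolding absolutely_continuous_on_def
  proof (intro allI impI)
    fix e :: real assume e: "e > 0"
    then have e': "e / (2 * M) > 0" using M by simp
    obtain d1 where d1: "d1 > 0" "\<And>P :: (real \<times> real) set.
        finite P \<and> (\<forall>(u, v)\<in>P. a \<le> u \<and> u < v \<and> v \<le> b) \<and>
        disjoint_family_on (\<lambda>(u, v). {u<..<v}) P \<and> (\<Sum>(u, v)\<in>P. v - u) < d1
        \<Longrightarrow> (\<Sum>(u, v)\<in>P. \<bar>f v - f u\<bar>) < e / (2 * M)"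
      using f e' unfolding absolutely_continuous_on_def by meson
    obtain d2 where d2: "d2 > 0" "\<And>P :: (real \<times> real) set.
        finite P \<and> (\<forall>(u, v)\<in>P. a \<le> u \<and> u < v \<and> v \<le> b) \<and>
        disjoint_family_on (\<lambda>(u, v). {u<..<v}) P \<and> (\<Sum>(u, v)\<in>P. v - u) < d2
        \<Longrightarrow> (\<Sum>(u, v)\<in>P. \<bar>g v - g u\<bar>) < e / (2 * M)"
      using g e' unfolding absolutely_continuous_on_def by meson
    have "(\<Sum>(u, v)\<in>P. \<bar>f v * g v - f u * g u\<bar>) < e"
      if P: "finite P \<and> (\<forall>(u, v)\<in>P. a \<le> u \<and> u < v \<and> v \<le> b) \<and>
        disjoint_family_on (\<lambda>(u, v). {u<..<v}) P \<and> (\<Sum>(u, v)\<in>P. v - u) < min d1 d2"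
      for P :: "(real \<times> real) set"
    proof -
      have "\<bar>f v * g v - f u * g u\<bar> \<le> M * \<bar>f v - f u\<bar> + M * \<bar>g v - g u\<bar>" if "(u, v) \<in> P" for u v
      proof -
        have uv: "u \<in> {a..b}" "v \<in> {a..b}" using P that by fastforce+
        have "f v * g v - f u * g u = (f v - f u) * g v + f u * (g v - g u)"
          by (simp add: algebra_simps)
        then have "\<bar>f v * g v - f u * g u\<bar> \<le> \<bar>f v - f u\<bar> * \<bar>g v\<bar> + \<bar>f u\<bar> * \<bar>g v - g u\<bar>"
          by (metis abs_mult abs_triangle_ineq)
        also have "\<dots> \<le> \<bar>f v - f u\<bar> * M + M * \<bar>g v - g u\<bar>"
          using M uv by (intro add_mono mult_mono) auto
        finally show ?thesis by (simp add: mult.commute)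
      qed
      then have "(\<Sum>(u, v)\<in>P. \<bar>f v * g v - f u * g u\<bar>)
          \<le> (\<Sum>(u, v)\<in>P. M * \<bar>f v - f u\<bar> + M * \<bar>g v - g u\<bar>)"
        by (intro sum_mono) auto
      also have "\<dots> = M * (\<Sum>(u, v)\<in>P. \<bar>f v - f u\<bar>) + M * (\<Sum>(u, v)\<in>P. \<bar>g v - g u\<bar>)"
        by (simp add: sum_distrib_left case_prod_beta sum.distrib)
      also have "\<dots> < M * (e / (2 * M)) + M * (e / (2 * M))"
        using d1(2)[of P] d2(2)[of P] P M(1) by (intro add_strict_mono mult_strict_left_mono) auto
      finally show ?thesis using M(1) by (simp add: field_simps)
    qed
    then show "\<exists>d>0. \<forall>P :: (real \<times> real) set.
        finite P \<and> (\<forall>(u, v)\<in>P. a \<le> u \<and> u < v \<and> v \<le> b) \<and>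
        disjoint_family_on (\<lambda>(u, v). {u<..<v}) P \<and> (\<Sum>(u, v)\<in>P. v - u) < d
        \<longrightarrow> (\<Sum>(u, v)\<in>P. \<bar>f v * g v - f u * g u\<bar>) < e"
      using d1(1) d2(1) by (intro exI[of _ "min d1 d2"]) auto
  qed
qed

section \<open>Primitives of bounded measurable functions\<close>

lemma AE_lebesgue_iff_lborel: "(AE x in lebesgue. P x) \<longleftrightarrow> (AE x in lborel. P x)"
  by (simp add: AE_completion_iff)

definition primitive :: "(real \<Rightarrow> real) \<Rightarrow> real \<Rightarrow> real" where
  "primitive f x = (LINT s:{0..x}|lborel. f s)"

lemma set_integrable_bounded:
  fixes f :: "real \<Rightarrow> real"
  assumes [measurable]: "f \<in> borel_measurable borel" and "\<And>x. \<bar>f x\<bar> \<le> M"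
  shows "set_integrable lborel {a..b} f"
proof (rule set_integrable_bound[where f = "\<lambda>_. M"])
  show "set_integrable lborel {a..b} (\<lambda>_. M)"
    by (auto simp: set_integrable_def emeasure_lborel_Icc_eq intro!: integrable_real_indicator)
  show "set_borel_measurable lborel {a..b} f"
    by (simp add: set_borel_measurable_def)
  show "AE x in lborel. x \<in> {a..b} \<longrightarrow> norm (f x) \<le> norm M"
    using assms(2) by (intro AE_I2 impI) (metis abs_ge_self order_trans real_norm_def)
qed

lemma primitive_add:
  assumes f: "f \<in> borel_measurable borel" "\<And>x. \<bar>f x\<bar> \<le> M" and "0 \<le> x" "0 \<le> h"
  shows "primitive f (x + h) = primitive f x + primitive (\<lambda>s. f (x + s)) h"
proof -
  have i: "f integrable_on {a..b}" "(LINT s:{a..b}|lborel. f s) = integral {a..b} f" for a b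
    using set_borel_integral_eq_integral[OF set_integrable_bounded[OF f]] by auto
  have "integral {0..x} f + integral {x..x + h} f = integral {0..x + h} f"
    using assms i by (intro Henstock_Kurzweil_Integration.integral_combine) auto
  moreover have "(LINT s:{x..x + h}|lborel. f s) = primitive (\<lambda>s. f (x + s)) h"
    unfolding primitive_def set_lebesgue_integral_def
    by (subst lborel_integral_real_affine[where c = 1 and t = x])
       (auto intro!: Bochner_Integration.integral_cong simp: indicator_def)
  ultimately show ?thesis
    by (simp add: primitive_def i)
qed

lemma primitive_mono:
  assumes "f \<in> borel_measurable borel" "\<And>x. \<bar>f x\<bar> \<le> M"
    and "g \<in> borel_measurable borel" "\<And>x. \<bar>g x\<bar> \<le> M'" and "\<And>x. f x \<le> g x"
  shows "primitive f x \<le> primitive g x"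
  unfolding primitive_def
  using assms by (intro set_integral_mono set_integrable_bounded) auto

lemma primitive_const: "0 \<le> x \<Longrightarrow> primitive (\<lambda>_. c) x = c * x"
  by (simp add: primitive_def set_lebesgue_integral_def)

lemma primitive_bounds:
  assumes f: "f \<in> borel_measurable borel" "\<And>x. \<alpha> \<le> f x" "\<And>x. f x \<le> \<beta>" and x: "0 \<le> x"
  shows "\<alpha> * x \<le> primitive f x" "primitive f x \<le> \<beta> * x"
proof -
  have b: "\<bar>f x\<bar> \<le> max \<bar>\<alpha>\<bar> \<bar>\<beta>\<bar>" for x using f(2,3)[of x] by linarith
  show "\<alpha> * x \<le> primitive f x"
    using primitive_mono[of "\<lambda>_. \<alpha>" "\<bar>\<alpha>\<bar>" f _ x, OF _ _ f(1) b f(2)] x by (simp add: primitive_const)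
  show "primitive f x \<le> \<beta> * x"
    using primitive_mono[of f _ "\<lambda>_. \<beta>" "\<bar>\<beta>\<bar>" x, OF f(1) b _ _ f(3)] x by (simp add: primitive_const)
qed

lemma primitive_Lipschitz:
  assumes f: "f \<in> borel_measurable borel" "\<And>x. \<bar>f x\<bar> \<le> M" and "0 \<le> x" "x \<le> y"
  shows "\<bar>primitive f y - primitive f x\<bar> \<le> M * (y - x)"
proof -
  have [measurable]: "(\<lambda>s. f (x + s)) \<in> borel_measurable borel" using f(1) by measurable
  have "primitive f y - primitive f x = primitive (\<lambda>s. f (x + s)) (y - x)"
    using primitive_add[OF f, of x "y - x"] assms by simp
  moreover have "- M * (y - x) \<le> primitive (\<lambda>s. f (x + s)) (y - x)"
     "primitive (\<lambda>s. f (x + s)) (y - x) \<le> M * (y - x)"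
    using f(2) assms(4) by (auto intro!: primitive_bounds[where \<alpha> = "- M" and \<beta> = M, simplified] simp: abs_le_iff minus_le_iff)
  ultimately show ?thesis by (simp add: abs_le_iff)
qed

text \<open>
  Lebesgue differentiation for averages over \<open>[x, x + h]\<close> (\<open>integrable_ccontinuous_explicit\<close>) gives
  the right derivative; applied to the reflected function, it gives the left derivative.
\<close>

lemma primitive_has_derivative_AE:
  assumes f: "f \<in> borel_measurable borel" "\<And>x. \<bar>f x\<bar> \<le> M"
  shows "AE x in lebesgue. 0 < x \<longrightarrow> (primitive f has_real_derivative f x) (at x)"
proof -
  define g where "g = (\<lambda>x. f (- x))"
  have g: "g \<in> borel_measurable borel" "\<And>x. \<bar>g x\<bar> \<le> M"
    using f unfolding g_def by auto
  have int_f: "f integrable_on {a..b}" and int_g: "g integrable_on {a..b}"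
    and prim: "(LINT s:{a..b}|lborel. f s) = integral {a..b} f" for a b
    using set_borel_integral_eq_integral[OF set_integrable_bounded[OF f]]
      set_borel_integral_eq_integral[OF set_integrable_bounded[OF g]] by auto
  obtain N1 where N1: "negligible N1" "\<And>x e. \<lbrakk>x \<notin> N1; 0 < e\<rbrakk> \<Longrightarrow>
      \<exists>d>0. \<forall>h. 0 < h \<and> h < d \<longrightarrow> norm (integral (cbox x (x + h *\<^sub>R One)) f /\<^sub>R h ^ DIM(real) - f x) < e"
    using integrable_ccontinuous_explicit[of f] int_f by (metis box_real(2))
  obtain N2 where N2: "negligible N2" "\<And>x e. \<lbrakk>x \<notin> N2; 0 < e\<rbrakk> \<Longrightarrow>
      \<exists>d>0. \<forall>h. 0 < h \<and> h < d \<longrightarrow> norm (integral (cbox x (x + h *\<^sub>R One)) g /\<^sub>R h ^ DIM(real) - g x) < e"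
    using integrable_ccontinuous_explicit[of g] int_g by (metis box_real(2))
  define N where "N = N1 \<union> uminus ` N2"
  have "negligible (uminus ` N2)"
    using N2(1) by (intro negligible_differentiable_image_negligible) (auto intro!: derivative_intros simp: differentiable_on_def)
  then have "negligible N" using N1(1) by (simp add: N_def)
  moreover have "(primitive f has_real_derivative f x) (at x)" if x: "x > 0" "x \<notin> N" for x
    unfolding DERIV_def
  proof (rule LIM_I)
    fix e :: real assume e: "e > 0"
    obtain d1 where d1: "d1 > 0" "\<And>h. 0 < h \<Longrightarrow> h < d1 \<Longrightarrow> \<bar>integral {x..x + h} f / h - f x\<bar> < e"
      using N1(2)[of x e] x e by (auto simp: N_def divide_inverse_commute)
    have "- x \<notin> N2" using x by (force simp: N_def)
    then obtain d2 where d2: "d2 > 0" "\<And>h. 0 < h \<Longrightarrow> h < d2 \<Longrightarrow> \<bar>integral {-x..-x + h} g / h - f x\<bar> < e"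
      using N2(2)[of "-x" e] e by (auto simp: g_def divide_inverse_commute)
    have d3: "\<bar>integral {x - h..x} f / h - f x\<bar> < e" if "0 < h" "h < d2" for h
      using d2(2)[OF that] Henstock_Kurzweil_Integration.integral_reflect_real[of x "x - h" f]
      by (simp add: g_def)
    have comb: "integral {0..u} f + integral {u..v} f = integral {0..v} f" if "0 \<le> u" "u \<le> v" for u v
      using that int_f by (intro Henstock_Kurzweil_Integration.integral_combine) auto
    have "norm ((primitive f (x + h) - primitive f x) / h - f x) < e"
      if h: "h \<noteq> 0" "norm (h - 0) < min x (min d1 d2)" for h
    proof (cases "h > 0")
      case True
      then have "primitive f (x + h) - primitive f x = integral {x..x + h} f"
        using comb[of x "x + h"] x by (simp add: primitive_def prim)
      then show ?thesis using d1(2)[of h] h True by simp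
    next
      case False
      then have "primitive f x - primitive f (x + h) = integral {x + h..x} f"
        using comb[of "x + h" x] x h by (simp add: primitive_def prim)
      then have "(primitive f (x + h) - primitive f x) / h = integral {x + h..x} f / (- h)"
        by (metis minus_diff_eq minus_divide_left minus_divide_right)
      then show ?thesis using d3[of "- h"] h False by simp
    qed
    then show "\<exists>s>0. \<forall>h. h \<noteq> 0 \<and> norm (h - 0) < s \<longrightarrow>
        norm ((primitive f (x + h) - primitive f x) / h - f x) < e"
      using x d1(1) d2(1) by (intro exI[of _ "min x (min d1 d2)"]) auto
  qed
  ultimately show ?thesis
    by (intro AE_I'[of N]) (auto simp: negligible_iff_null_sets)
qed

lemma measurable_primitive:
  assumes [measurable]: "(\<lambda>(z, s). f z s) \<in> borel_measurable (M \<Otimes>\<^sub>M borel)" "g \<in> borel_measurable M"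
  shows "(\<lambda>z. primitive (f z) (g z)) \<in> borel_measurable M"
proof -
  have "(\<lambda>z. primitive (f z) (g z)) = (\<lambda>z. LINT s|lborel. (if 0 \<le> s \<and> s \<le> g z then f z s else 0))"
    by (auto simp: primitive_def set_lebesgue_integral_def indicator_def intro!: Bochner_Integration.integral_cong)
  also have "\<dots> \<in> borel_measurable M"
    by measurable
  finally show ?thesis .
qed

text \<open>
  Replaces the integral over a characteristic of a rate that is known only almost everywhere by a
  primitive of its Borel version; the measurability of \<open>f\<close> comes with the conclusion, because
  Lebesgue measure is complete.
\<close>

lemma lebesgue_integral_eq_primitive:
  fixes f g :: "real \<Rightarrow> real"
  assumes g: "g \<in> borel_measurable borel" "\<And>x. \<bar>g x\<bar> \<le> M"
    and eq: "AE s in lborel. 0 < s \<and> s < t \<longrightarrow> f s = g s"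
  shows "(LINT s|lebesgue_on {0..t}. f s) = primitive g t"
proof -
  obtain N where "N \<in> null_sets lborel" and N0: "\<And>s. s \<notin> N \<Longrightarrow> 0 < s \<and> s < t \<longrightarrow> f s = g s"
    using eq unfolding eventually_ae_filter by auto
  then have N: "negligible N" "\<And>s. s \<notin> N \<Longrightarrow> 0 < s \<and> s < t \<longrightarrow> f s = g s"
    by (auto simp: negligible_iff_null_sets intro: null_sets_completionI)
  define N' where "N' = insert 0 (insert t N)"
  have N': "negligible N'" "\<And>s. s \<in> {0..t} - N' \<Longrightarrow> f s = g s"
    using N unfolding N'_def by (auto simp: less_eq_real_def)
  have gi: "set_integrable lborel {0..t} g"
    using g by (rule set_integrable_bounded)
  have "(\<lambda>s. indicat_real {0..t} s *\<^sub>R g s) \<in> borel_measurable lborel"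
    using g(1) by measurable
  then have ga: "g absolutely_integrable_on {0..t}"
    using gi unfolding set_integrable_def by (simp add: integrable_completion)
  then have fa: "f absolutely_integrable_on {0..t}"
    using N' by (rule absolutely_integrable_spike)
  have "(LINT s|lebesgue_on {0..t}. f s) = (LINT s:{0..t}|lebesgue. f s)"
    unfolding set_lebesgue_integral_def by (rule integral_restrict_space) auto
  also have "\<dots> = integral {0..t} f"
    using fa by (rule set_lebesgue_integral_eq_integral)
  also have "\<dots> = integral {0..t} g"
    using N' by (intro integral_spike) auto
  also have "\<dots> = primitive g t"
    unfolding primitive_def using gi by (simp add: set_borel_integral_eq_integral)
  finally show ?thesis .
qed

section \<open>Shifts, exponentials and integrals over the half line\<close>

lemma AE_lborel_shift:
  fixes h :: real
  assumes "AE x in lborel. P x"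
  shows "AE y in lborel. P (y + h)"
proof -
  obtain N where N: "N \<in> null_sets lborel" "\<And>x. x \<notin> N \<Longrightarrow> P x"
    using assms unfolding eventually_ae_filter by auto
  have "{y. y - (- h) \<in> N} \<in> null_sets lborel"
    by (rule null_sets_translation[OF N(1)])
  then show ?thesis
    by (rule AE_I') (use N(2) in auto)
qed

lemma lborel_integral_shift:
  fixes f :: "real \<Rightarrow> real"
  shows "(LINT y|lborel. f (y + h)) = (LINT x|lborel. f x)"
    and "integrable lborel f \<Longrightarrow> integrable lborel (\<lambda>y. f (y + h))"
  using lborel_integral_real_affine[of 1 f h] lborel_integrable_real_affine[of f 1 h]
  by (simp_all add: add.commute)

lemma AE_half_line_iff: "(AE x in half_line. P x) \<longleftrightarrow> (AE x in lborel. 0 < x \<longrightarrow> P x)"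
  by (subst AE_restrict_space_iff) (auto simp: AE_completion_iff)

lemma half_line_integral:
  fixes f v :: "real \<Rightarrow> real"
  assumes f: "f \<in> borel_measurable half_line" and v: "v \<in> borel_measurable borel" "\<And>x. x \<le> 0 \<Longrightarrow> v x = 0"
    and eq: "AE x in lborel. 0 < x \<longrightarrow> f x = v x"
  shows "(LINT x|half_line. f x) = (LINT x|lborel. v x)"
    and "integrable half_line f \<longleftrightarrow> integrable lborel v"
proof -
  have m: "(\<lambda>x. indicator {0<..} x *\<^sub>R f x) \<in> borel_measurable lebesgue" "v \<in> borel_measurable lebesgue"
    using f v by (auto simp: borel_measurable_restrict_space_iff intro!: measurable_completion)
  have ae: "AE x in lebesgue. indicator {0<..} x *\<^sub>R f x = v x"
    unfolding AE_lebesgue_iff_lborel using eq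
    by eventually_elim (use v(2) in \<open>auto simp: indicator_def\<close>)
  have "(LINT x|half_line. f x) = (LINT x|lebesgue. indicator {0<..} x *\<^sub>R f x)"
    by (rule integral_restrict_space) auto
  also have "\<dots> = (LINT x|lebesgue. v x)"
    using m ae by (rule integral_cong_AE)
  also have "\<dots> = (LINT x|lborel. v x)"
    using v by (intro integral_completion) auto
  finally show "(LINT x|half_line. f x) = (LINT x|lborel. v x)" .
  have "integrable half_line f \<longleftrightarrow> integrable lebesgue (\<lambda>x. indicator {0<..} x *\<^sub>R f x)"
    by (rule integrable_restrict_space) auto
  also have "\<dots> \<longleftrightarrow> integrable lebesgue v"
    using m ae by (rule integrable_cong_AE)
  also have "\<dots> \<longleftrightarrow> integrable lborel v"
    using v by (intro integrable_completion) auto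
  finally show "integrable half_line f \<longleftrightarrow> integrable lborel v" .
qed

lemma exp_decay_integral:
  fixes c :: real
  assumes "c > 0"
  shows "set_integrable lborel {0..} (\<lambda>x. exp (- c * x))"
    and "(LINT x:{0..}|lborel. exp (- c * x)) = 1 / c"
proof -
  have "(\<integral>\<^sup>+x. ennreal (exp (- c * x)) * indicator {0 ..} x \<partial>lborel) = ennreal (0 - (- exp (- c * 0) / c))"
  proof (rule nn_integral_FTC_atLeast[where F = "\<lambda>x. - exp (- c * x) / c"])
    fix x show "((\<lambda>x. - exp (- c * x) / c) has_real_derivative exp (- c * x)) (at x)"
      using assms by (auto intro!: derivative_eq_intros)
    have "filterlim (\<lambda>x. - (c * x)) at_bot at_top"
      using assms by (intro filterlim_compose[OF filterlim_uminus_at_bot_at_top] filterlim_tendsto_pos_mult_at_top[OF tendsto_const] filterlim_ident)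
    then have "((\<lambda>x. exp (- (c * x))) \<longlongrightarrow> 0) at_top"
      by (rule filterlim_compose[OF exp_at_bot])
    then have "((\<lambda>x. - exp (- (c * x)) / c) \<longlongrightarrow> - 0 / c) at_top"
      using assms by (intro tendsto_intros) auto
    then show "((\<lambda>x. - exp (- c * x) / c) \<longlongrightarrow> 0) at_top"
      by simp
  qed auto
  then have "(\<integral>\<^sup>+x. ennreal (indicator {0..} x *\<^sub>R exp (- c * x)) \<partial>lborel) = ennreal (1 / c)"
    by (simp add: indicator_mult_ennreal mult.commute)
  then have "has_bochner_integral lborel (\<lambda>x. indicator {0..} x *\<^sub>R exp (- c * x)) (1 / c)"
    using assms by (intro has_bochner_integral_nn_integral) auto
  then show "set_integrable lborel {0..} (\<lambda>x. exp (- c * x))"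
    and "(LINT x:{0..}|lborel. exp (- c * x)) = 1 / c"
    by (auto simp: set_integrable_def set_lebesgue_integral_def has_bochner_integral_iff)
qed

lemma exp_minus_Lipschitz:
  fixes p q :: real
  assumes "0 \<le> p" "0 \<le> q"
  shows "\<bar>exp (- p) - exp (- q)\<bar> \<le> \<bar>p - q\<bar>"
proof -
  have *: "exp (- u) - exp (- v) \<le> v - u" if "0 \<le> u" "u \<le> v" for u v :: real
  proof -
    have "exp (- u) - exp (- v) = exp (- u) * (1 - exp (- (v - u)))"
      by (simp add: algebra_simps flip: exp_add)
    also have "\<dots> \<le> 1 * (v - u)"
      using that exp_ge_add_one_self[of "- (v - u)"] by (intro mult_mono) (auto simp: algebra_simps)
    finally show ?thesis by simp
  qed
  show ?thesis
    using *[of p q] *[of q p] assms by (cases "p \<le> q") (auto simp: abs_if)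
qed

text \<open>
  One characteristic carries \<open>a\<close> with accumulated hazard \<open>A\<close> and \<open>b\<close> with accumulated hazard \<open>B\<close>.
  The difference \<open>a - b\<close> itself decays by \<open>1 - A\<close> to first order, and \<open>b\<close> is exposed to the
  difference of the hazards.
\<close>

lemma decay_difference_bound:
  fixes a b A B :: real
  assumes "0 \<le> A" "0 \<le> B" "0 \<le> b"
  shows "\<bar>a * exp (- A) - b * exp (- B)\<bar> \<le> \<bar>a - b\<bar> * (1 - A + A\<^sup>2 / 2) + b * \<bar>A - B\<bar>"
proof -
  have e2: "exp (- A) \<le> 1 - A + A\<^sup>2 / 2"
  proof -
    define f where "f x = 1 - x + x\<^sup>2 / 2 - exp (- x)" for x :: real
    have "f 0 \<le> f A"
    proof (rule DERIV_nonneg_imp_nondecreasing[OF assms(1)])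
      fix x :: real assume "0 \<le> x"
      show "\<exists>y. DERIV f x :> y \<and> y \<ge> 0"
        unfolding f_def[abs_def] using exp_ge_add_one_self[of "- x"]
        by (intro exI[of _ "- 1 + x + exp (- x)"] conjI) (auto intro!: derivative_eq_intros)
    qed
    then show ?thesis by (simp add: f_def)
  qed
  have "\<bar>exp (- A) - exp (- B)\<bar> \<le> \<bar>A - B\<bar>"
    using assms(1,2) by (rule exp_minus_Lipschitz)
  then have "b * \<bar>exp (- A) - exp (- B)\<bar> \<le> b * \<bar>A - B\<bar>"
    using assms by (intro mult_left_mono)
  moreover have "\<bar>a - b\<bar> * exp (- A) \<le> \<bar>a - b\<bar> * (1 - A + A\<^sup>2 / 2)"
    using e2 by (intro mult_left_mono) auto
  moreover have "a * exp (- A) - b * exp (- B) = (a - b) * exp (- A) + b * (exp (- A) - exp (- B))"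
    by (simp add: algebra_simps)
  then have "\<bar>a * exp (- A) - b * exp (- B)\<bar> \<le> \<bar>a - b\<bar> * exp (- A) + b * \<bar>exp (- A) - exp (- B)\<bar>"
    using assms by (metis abs_exp_cancel abs_mult abs_of_nonneg abs_triangle_ineq)
  ultimately show ?thesis by linarith
qed

section \<open>A Borel version of the rate\<close>

lemma nonincreasing_on_Icc:
  fixes g dg :: "real \<Rightarrow> real"
  assumes "\<And>J. J \<in> {a..b} \<Longrightarrow> (g has_real_derivative dg J) (at J within {a..b})"
    and "\<And>J. J \<in> {a..b} \<Longrightarrow> dg J \<le> 0" and "a \<le> J" "J \<le> K" "K \<le> b"
  shows "g K \<le> g J"
proof (rule DERIV_nonpos_imp_decreasing_open[OF \<open>J \<le> K\<close>])
  have "continuous_on {a..b} g"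
    using assms(1) by (rule DERIV_continuous_on)
  then show "continuous_on {J..K} g"
    by (rule continuous_on_subset) (use assms in auto)
  fix x assume x: "J < x" "x < K"
  then have "x \<in> {a..b}" "at x within {a..b} = at x"
    using assms by (auto intro!: at_within_Icc_at)
  then show "\<exists>y. (g has_real_derivative y) (at x) \<and> y \<le> 0"
    using assms(1,2)[of x] by auto
qed

text \<open>
  For each rational activity the rate has a Borel version in the age, and the countably many
  exceptional sets lie in one null set \<open>N\<close>. Off \<open>N\<close> continuity in the activity recovers all other
  values: the function is a pointwise limit of functions that use only the activities
  \<open>\<lfloor>J (k + 1)\<rfloor> / (k + 1)\<close>, hence is jointly Borel. Clipping the activity to \<open>[0, R]\<close> and the default
  value \<open>c\<close> extend it to the whole plane, so that bounds, continuity and monotonicity in the activity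
  hold without side conditions.
\<close>

lemma Caratheodory_borel_version:
  fixes r :: "real \<Rightarrow> real \<Rightarrow> real"
  assumes R: "0 \<le> R"
    and meas: "\<And>J. J \<in> {0..R} \<Longrightarrow> (\<lambda>x. r x J) \<in> borel_measurable half_line"
    and cont: "\<And>x. x > 0 \<Longrightarrow> continuous_on {0..R} (r x)"
  obtains \<rho> N where "N \<in> null_sets lborel" "case_prod \<rho> \<in> borel_measurable borel"
    "\<And>x J. \<rho> x J = (if x \<in> N \<or> x \<le> 0 then c else r x (max 0 (min R J)))"
proof -
  define clip where "clip J = max 0 (min R J)" for J
  have clip: "clip J \<in> {0..R}" for J using R by (auto simp: clip_def)
  have "(\<lambda>x. if x \<in> {0<..} then r x (clip q) else 0) \<in> borel_measurable lebesgue" for q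
    using meas[OF clip] by (rule borel_measurable_if_I) simp
  then have "\<forall>q. \<exists>g. g \<in> borel_measurable lborel \<and>
      (AE x in lborel. (if x \<in> {0<..} then r x (clip q) else 0) = g x)"
    unfolding Bex_def[symmetric] by (intro allI completion_ex_borel_measurable_real)
  then obtain g :: "real \<Rightarrow> real \<Rightarrow> real" where g: "\<And>q. g q \<in> borel_measurable lborel"
     "\<And>q. AE x in lborel. (if x \<in> {0<..} then r x (clip q) else 0) = g q x"
    by (auto dest!: choice simp del: split_paired_All split del: if_split)
  have "AE x in lborel. \<forall>q::rat. (if x \<in> {0<..} then r x (clip (of_rat q)) else 0) = g (of_rat q) x"
    by (subst AE_all_countable) (intro allI g(2))
  then obtain N where N: "N \<in> null_sets lborel"
    "\<And>x q. x \<notin> N \<Longrightarrow> (if x \<in> {0<..} then r x (clip (of_rat q)) else 0) = g (of_rat q) x"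
  proof -
    assume ae: "AE x in lborel. \<forall>q::rat. (if x \<in> {0<..} then r x (clip (of_rat q)) else 0) = g (of_rat q) x"
    assume th: "\<And>N. N \<in> null_sets lborel \<Longrightarrow>
      (\<And>x q. x \<notin> N \<Longrightarrow> (if x \<in> {0<..} then r x (clip (of_rat q)) else 0) = g (of_rat q) x) \<Longrightarrow> thesis"
    obtain N where "N \<in> null_sets lborel"
      "{x \<in> space lborel. \<not> (\<forall>q::rat. (if x \<in> {0<..} then r x (clip (of_rat q)) else 0) = g (of_rat q) x)} \<subseteq> N"
      using ae unfolding eventually_ae_filter by blast
    then show thesis by (intro th[of N]) (auto split del: if_split)
  qed
  define \<rho> where "\<rho> x J = (if x \<in> N \<or> x \<le> 0 then c else r x (clip J))" for x J
  have [measurable]: "N \<in> sets borel" "\<And>q. g q \<in> borel_measurable borel"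
    using N(1) g(1) by (auto simp: null_sets_def)
  have rat: "(\<lambda>x. \<rho> x (of_rat q)) \<in> borel_measurable borel" for q :: rat
  proof -
    have "(\<lambda>x. \<rho> x (of_rat q)) = (\<lambda>x. if x \<in> N \<or> x \<le> 0 then c else g (of_rat q) x)"
      by (auto simp: \<rho>_def fun_eq_iff N(2)[symmetric])
    then show ?thesis by simp
  qed
  define a :: "nat \<Rightarrow> int \<Rightarrow> real" where "a k i = of_int i / of_nat (Suc k)" for k i
  have approx: "(\<lambda>z. \<rho> (fst z) (a k \<lfloor>snd z * real (Suc k)\<rfloor>)) \<in> borel_measurable (borel \<Otimes>\<^sub>M borel)" for k
  proof (rule measurable_compose_countable[where f = "\<lambda>i z. \<rho> (fst z) (a k i)"])
    fix i :: int
    have "a k i = of_rat (of_int i / of_nat (Suc k))"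
      by (simp add: a_def of_rat_divide del: of_nat_Suc)
    then have [measurable]: "(\<lambda>x. \<rho> x (a k i)) \<in> borel_measurable borel"
      using rat by simp
    show "(\<lambda>z. \<rho> (fst z) (a k i)) \<in> borel_measurable (borel \<Otimes>\<^sub>M borel)"
      by measurable
  qed measurable
  have "(\<lambda>z. \<rho> (fst z) (snd z)) \<in> borel_measurable (borel \<Otimes>\<^sub>M borel)"
  proof (rule borel_measurable_LIMSEQ_real[OF _ approx])
    fix z :: "real \<times> real"
    obtain x J where z: "z = (x, J)" by (cases z)
    have "(\<lambda>k. a k \<lfloor>J * real (Suc k)\<rfloor>) \<longlonglongrightarrow> J"
    proof (rule tendsto_sandwich)
      show "\<forall>\<^sub>F k in sequentially. J - 1 / real (Suc k) \<le> a k \<lfloor>J * real (Suc k)\<rfloor>"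
      proof (intro always_eventually allI)
        fix k
        have "J * real (Suc k) - 1 \<le> \<lfloor>J * real (Suc k)\<rfloor>" by linarith
        then have "(J * real (Suc k) - 1) / real (Suc k) \<le> a k \<lfloor>J * real (Suc k)\<rfloor>"
          unfolding a_def by (intro divide_right_mono) auto
        then show "J - 1 / real (Suc k) \<le> a k \<lfloor>J * real (Suc k)\<rfloor>"
          by (simp add: diff_divide_distrib del: of_nat_Suc)
      qed
      show "\<forall>\<^sub>F k in sequentially. a k \<lfloor>J * real (Suc k)\<rfloor> \<le> J"
        by (intro always_eventually allI) (simp add: a_def divide_le_eq del: of_nat_Suc)
      show "(\<lambda>k. J - 1 / real (Suc k)) \<longlonglongrightarrow> J"
        using tendsto_diff[OF tendsto_const LIMSEQ_inverse_real_of_nat, of J]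
        by (simp add: inverse_eq_divide)
    qed simp
    then have "(\<lambda>k. clip (a k \<lfloor>J * real (Suc k)\<rfloor>)) \<longlonglongrightarrow> clip J"
      unfolding clip_def by (intro tendsto_intros)
    then have "x > 0 \<Longrightarrow> (\<lambda>k. r x (clip (a k \<lfloor>J * real (Suc k)\<rfloor>))) \<longlonglongrightarrow> r x (clip J)"
      using continuous_on_tendsto_compose[OF cont[of x], of "\<lambda>k. clip (a k \<lfloor>J * real (Suc k)\<rfloor>)" "clip J" sequentially] clip
      by simp
    then show "(\<lambda>k. \<rho> (fst z) (a k \<lfloor>snd z * real (Suc k)\<rfloor>)) \<longlonglongrightarrow> \<rho> (fst z) (snd z)"
      by (simp add: z \<rho>_def)
  qed
  then have "case_prod \<rho> \<in> borel_measurable borel"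
    by (simp add: borel_prod split_beta')
  then show thesis
    using that[of N \<rho>] N(1) by (simp add: \<rho>_def clip_def)
qed

section \<open>Survival function and equilibrium activity\<close>

locale firing_rate =
  fixes \<rho> :: "real \<Rightarrow> real \<Rightarrow> real" and r\<^sub>0 r\<^sub>M :: real
  assumes rate_measurable: "case_prod \<rho> \<in> borel_measurable borel"
    and rate_lower_pos: "0 < r\<^sub>0"
    and rate_lower: "r\<^sub>0 \<le> \<rho> x J" and rate_upper: "\<rho> x J \<le> r\<^sub>M"
    and rate_antimono: "J \<le> K \<Longrightarrow> \<rho> x K \<le> \<rho> x J"
    and rate_cont: "isCont (\<rho> x) J"
begin

lemma rate_compose_measurable [measurable (raw)]:
  assumes "f \<in> borel_measurable M" "g \<in> borel_measurable M"
  shows "(\<lambda>x. \<rho> (f x) (g x)) \<in> borel_measurable M"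
  using measurable_compose[OF _ rate_measurable, of "\<lambda>x. (f x, g x)" M] assms
  by (simp add: borel_prod[symmetric])

lemma rate_nonneg: "0 \<le> \<rho> x J"
  using rate_lower[of x J] rate_lower_pos by linarith

lemma rate_abs: "\<bar>\<rho> x J\<bar> \<le> r\<^sub>M"
  using rate_upper[of x J] rate_nonneg[of x J] by simp

lemma rate_max_pos: "0 < r\<^sub>M"
  using rate_lower[of 0 0] rate_upper[of 0 0] rate_lower_pos by linarith

definition survival :: "real \<Rightarrow> real \<Rightarrow> real" where
  "survival J x = exp (- primitive (\<lambda>s. \<rho> s J) x)"

lemma survival_measurable [measurable (raw)]:
  assumes "f \<in> borel_measurable M" "g \<in> borel_measurable M"
  shows "(\<lambda>z. survival (f z) (g z)) \<in> borel_measurable M"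
proof -
  note [measurable] = assms
  have "(\<lambda>z. primitive (\<lambda>s. \<rho> s (f z)) (g z)) \<in> borel_measurable M"
    by (rule measurable_primitive) measurable
  then show ?thesis unfolding survival_def by measurable
qed

lemma survival_bounds:
  assumes "0 \<le> x"
  shows "exp (- r\<^sub>M * x) \<le> survival J x" "survival J x \<le> exp (- r\<^sub>0 * x)"
proof -
  have "r\<^sub>0 * x \<le> primitive (\<lambda>s. \<rho> s J) x" "primitive (\<lambda>s. \<rho> s J) x \<le> r\<^sub>M * x"
    using assms rate_lower rate_upper by (auto intro!: primitive_bounds)
  then show "exp (- r\<^sub>M * x) \<le> survival J x" "survival J x \<le> exp (- r\<^sub>0 * x)"
    by (auto simp: survival_def)
qed

lemma primitive_rate_nonneg: "0 \<le> primitive (\<lambda>s. \<rho> s J) x"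
  unfolding primitive_def set_lebesgue_integral_def
  by (intro integral_nonneg_AE) (auto simp: rate_nonneg)

lemma survival_le_1: "survival J x \<le> 1"
  using primitive_rate_nonneg[of J x] by (simp add: survival_def)

lemma survival_nonneg: "0 \<le> survival J x"
  by (simp add: survival_def)

lemma survival_0: "survival J 0 = 1"
proof -
  have "primitive (\<lambda>s. \<rho> s J) 0 = 0"
    using primitive_bounds[of "\<lambda>s. \<rho> s J" r\<^sub>0 r\<^sub>M 0] rate_lower rate_upper by simp
  then show ?thesis by (simp add: survival_def)
qed

lemma survival_integrable: "set_integrable lborel {0..} (survival J)"
proof (rule set_integrable_bound[OF exp_decay_integral(1)[OF rate_lower_pos]])
  show "set_borel_measurable lborel {0..} (survival J)"
    unfolding set_borel_measurable_def by measurable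
  show "AE x in lborel. x \<in> {0..} \<longrightarrow> norm (survival J x) \<le> norm (exp (- r\<^sub>0 * x))"
    using survival_bounds survival_nonneg by (auto intro!: AE_I2)
qed

lemma survival_has_derivative:
  "AE x in lborel. 0 < x \<longrightarrow> (survival J has_real_derivative - \<rho> x J * survival J x) (at x)"
proof -
  have "AE x in lborel. 0 < x \<longrightarrow> (primitive (\<lambda>s. \<rho> s J) has_real_derivative \<rho> x J) (at x)"
    using primitive_has_derivative_AE[of "\<lambda>s. \<rho> s J" r\<^sub>M] rate_abs
    by (simp add: AE_lebesgue_iff_lborel)
  then show ?thesis
  proof eventually_elim
    case (elim x)
    then show ?case
      unfolding survival_def[abs_def] by (auto intro!: derivative_eq_intros)
  qed
qed

lemma survival_Lipschitz:
  assumes xy: "0 \<le> x" "x \<le> y"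
  shows "\<bar>survival J y - survival J x\<bar> \<le> r\<^sub>M * (y - x)"
proof -
  have "\<bar>survival J y - survival J x\<bar> \<le> \<bar>primitive (\<lambda>s. \<rho> s J) y - primitive (\<lambda>s. \<rho> s J) x\<bar>"
    unfolding survival_def by (intro exp_minus_Lipschitz primitive_rate_nonneg)
  also have "\<dots> \<le> r\<^sub>M * (y - x)"
    using xy rate_abs by (intro primitive_Lipschitz) auto
  finally show ?thesis .
qed

lemma survival_AC: "absolutely_continuous_on 0 b (survival J)"
  using survival_Lipschitz by (rule Lipschitz_imp_AC)

text \<open>
  The integrating factor turns the ODE into a vanishing derivative almost everywhere; as the
  product with the integrating factor stays absolutely continuous, it is constant.
\<close>

lemma ODE_solution_is_survival:
  assumes ac: "\<And>b. b > 0 \<Longrightarrow> absolutely_continuous_on 0 b \<mu>"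
    and ode: "AE x in lborel. 0 < x \<longrightarrow> (\<exists>d. (\<mu> has_real_derivative d) (at x) \<and> d + \<rho> x J * \<mu> x = 0)"
    and x: "0 \<le> x"
  shows "\<mu> x = \<mu> 0 * survival J x"
proof (cases "x = 0")
  case True
  then show ?thesis by (simp add: survival_0)
next
  case False
  then have x: "x > 0" using x by simp
  define A where "A = primitive (\<lambda>s. \<rho> s J)"
  have A_le: "A y \<le> r\<^sub>M * x" if "0 \<le> y" "y \<le> x" for y
  proof -
    have "A y \<le> r\<^sub>M * y"
      unfolding A_def using rate_lower rate_upper that by (intro primitive_bounds) auto
    also have "\<dots> \<le> r\<^sub>M * x"
      using that rate_max_pos by simp
    finally show ?thesis .
  qed
  have "absolutely_continuous_on 0 x (\<lambda>y. exp (A y))"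
  proof (rule Lipschitz_imp_AC)
    fix u v assume uv: "0 \<le> u" "u \<le> v" "v \<le> x"
    have lip: "\<bar>A v - A u\<bar> \<le> r\<^sub>M * (v - u)"
      unfolding A_def using uv rate_abs by (intro primitive_Lipschitz) auto
    have e: "exp p - exp q \<le> exp (r\<^sub>M * x) * \<bar>p - q\<bar>" if "p \<le> r\<^sub>M * x" for p q
    proof (cases "q \<le> p")
      case True
      have "exp p - exp q = exp p * (1 - exp (q - p))"
        by (simp add: algebra_simps flip: exp_add)
      also have "\<dots> \<le> exp (r\<^sub>M * x) * (p - q)"
        using that True exp_ge_add_one_self[of "q - p"] by (intro mult_mono) (auto simp: algebra_simps)
      finally show ?thesis using True by simp
    next
      case False
      then have "exp p - exp q \<le> 0" by simp
      also have "0 \<le> exp (r\<^sub>M * x) * \<bar>p - q\<bar>" by simp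
      finally show ?thesis .
    qed
    have "\<bar>exp (A v) - exp (A u)\<bar> \<le> exp (r\<^sub>M * x) * \<bar>A v - A u\<bar>"
      using e[OF A_le, of v "A u"] e[OF A_le, of u "A v"] uv by (simp add: abs_if split: if_splits)
    also have "\<dots> \<le> exp (r\<^sub>M * x) * (r\<^sub>M * (v - u))"
      using lip by simp
    finally show "\<bar>exp (A v) - exp (A u)\<bar> \<le> exp (r\<^sub>M * x) * r\<^sub>M * (v - u)" by simp
  qed
  then have AC: "absolutely_continuous_on 0 x (\<lambda>y. \<mu> y * exp (A y))"
    by (intro AC_mult ac x)
  have "AE y in lborel. 0 < y \<longrightarrow> (A has_real_derivative \<rho> y J) (at y)"
    unfolding A_def using primitive_has_derivative_AE[of "\<lambda>s. \<rho> s J" r\<^sub>M] rate_abs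
    by (simp add: AE_lebesgue_iff_lborel)
  with ode have "AE y in lborel. 0 < y \<and> y < x \<longrightarrow> ((\<lambda>y. \<mu> y * exp (A y)) has_real_derivative 0) (at y)"
  proof eventually_elim
    case (elim y)
    show ?case
    proof
      assume y: "0 < y \<and> y < x"
      then obtain d where d: "(\<mu> has_real_derivative d) (at y)" "d + \<rho> y J * \<mu> y = 0"
        using elim by auto
      have "((\<lambda>y. \<mu> y * exp (A y)) has_real_derivative (d + \<rho> y J * \<mu> y) * exp (A y)) (at y)"
        using elim y d(1) by (auto intro!: derivative_eq_intros simp: algebra_simps)
      then show "((\<lambda>y. \<mu> y * exp (A y)) has_real_derivative 0) (at y)"
        using d(2) by simp
    qed
  qed
  then have "\<mu> x * exp (A x) = \<mu> 0 * exp (A 0)"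
    using AC_zero_derivative_imp_const[OF _ AC] x by (simp add: AE_lebesgue_iff_lborel)
  then show ?thesis
    using survival_0[of J] by (simp add: survival_def A_def exp_minus field_simps)
qed

text \<open>
  Balance of the discharges: those that have not survived to age \<open>b\<close> have fired. Both sides are
  Lipschitz with the same derivative almost everywhere.
\<close>

lemma primitive_rate_survival:
  assumes "0 \<le> b"
  shows "primitive (\<lambda>s. \<rho> s J * survival J s) b = 1 - survival J b"
proof -
  define P where "P = primitive (\<lambda>s. \<rho> s J * survival J s)"
  have m: "(\<lambda>s. \<rho> s J * survival J s) \<in> borel_measurable borel" by measurable
  have bd: "0 \<le> \<rho> s J * survival J s" "\<rho> s J * survival J s \<le> r\<^sub>M" for s
    using mult_mono[OF rate_upper survival_le_1, of J s s J] rate_max_pos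
    by (auto simp: rate_nonneg survival_nonneg)
  then have bd': "\<bar>\<rho> s J * survival J s\<bar> \<le> r\<^sub>M" for s using bd[of s] by linarith
  have P0: "P 0 = 0" unfolding P_def using primitive_bounds[OF m bd, of 0] by simp
  obtain L where L: "\<And>x y. 0 \<le> x \<Longrightarrow> x \<le> y \<Longrightarrow> \<bar>P y - P x\<bar> \<le> L * (y - x)"
    unfolding P_def using primitive_Lipschitz[OF m bd'] by blast
  have "(\<lambda>s. survival J s + P s) b = (\<lambda>s. survival J s + P s) 0"
  proof (rule AC_zero_derivative_imp_const[OF assms])
    show "absolutely_continuous_on 0 b (\<lambda>s. survival J s + P s)"
    proof (rule Lipschitz_imp_AC)
      fix x y :: real assume xy: "0 \<le> x" "x \<le> y"
      show "\<bar>(survival J y + P y) - (survival J x + P x)\<bar> \<le> (r\<^sub>M + L) * (y - x)"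
        using survival_Lipschitz[OF xy, of J] L[OF xy] by (simp add: algebra_simps abs_le_iff)
    qed
    have "AE x in lborel. 0 < x \<longrightarrow> (P has_real_derivative \<rho> x J * survival J x) (at x)"
      unfolding P_def using primitive_has_derivative_AE[OF m bd']
      by (simp add: AE_lebesgue_iff_lborel)
    then show "AE x in lebesgue. 0 < x \<and> x < b \<longrightarrow>
        ((\<lambda>s. survival J s + P s) has_real_derivative 0) (at x)"
      unfolding AE_lebesgue_iff_lborel using survival_has_derivative[of J]
      by eventually_elim (auto intro!: derivative_eq_intros)
  qed
  then show ?thesis using P0 by (simp add: survival_0 P_def)
qed

text \<open>
  As \<open>r\<^sub>0 > 0\<close>, nobody survives forever. This makes the consistency condition
  \<open>J = \<integral>r(x, J) \<nu>(x) dx\<close> automatic for \<open>\<nu> = J \<cdot> survival\<close>, so that mass \<open>1\<close> is the only equation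
  left for \<open>J\<close>.
\<close>

lemma rate_survival_integral:
  "set_integrable lborel {0..} (\<lambda>x. \<rho> x J * survival J x)"
  "(LINT x:{0..}|lborel. \<rho> x J * survival J x) = 1"
proof -
  show i: "set_integrable lborel {0..} (\<lambda>x. \<rho> x J * survival J x)"
  proof (rule set_integrable_bound)
    show "set_integrable lborel {0..} (\<lambda>x. r\<^sub>M * survival J x)"
      using survival_integrable[of J] by simp
    show "set_borel_measurable lborel {0..} (\<lambda>x. \<rho> x J * survival J x)"
      unfolding set_borel_measurable_def by measurable
    show "AE x in lborel. x \<in> {0..} \<longrightarrow> norm (\<rho> x J * survival J x) \<le> norm (r\<^sub>M * survival J x)"
      using rate_abs rate_max_pos by (auto intro!: AE_I2 mult_mono simp: abs_mult)
  qed
  have "((\<lambda>b. primitive (\<lambda>s. \<rho> s J * survival J s) b) \<longlongrightarrow> (LINT x:{0..}|lborel. \<rho> x J * survival J x)) at_top"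
    unfolding primitive_def by (rule tendsto_set_lebesgue_integral_at_top[OF _ i]) auto
  moreover have "((\<lambda>b. primitive (\<lambda>s. \<rho> s J * survival J s) b) \<longlongrightarrow> 1) at_top"
  proof (rule Lim_transform_eventually)
    have "(survival J \<longlongrightarrow> 0) at_top"
    proof (rule tendsto_sandwich)
      show "\<forall>\<^sub>F x in at_top. 0 \<le> survival J x" by (simp add: survival_nonneg)
      show "\<forall>\<^sub>F x in at_top. survival J x \<le> exp (- (r\<^sub>0 * x))"
        using eventually_ge_at_top[of 0] by eventually_elim (use survival_bounds in auto)
      have "filterlim (\<lambda>x. - (r\<^sub>0 * x)) at_bot at_top"
        using rate_lower_pos by (intro filterlim_compose[OF filterlim_uminus_at_bot_at_top] filterlim_tendsto_pos_mult_at_top[OF tendsto_const] filterlim_ident)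
      then show "((\<lambda>x. exp (- (r\<^sub>0 * x))) \<longlongrightarrow> 0) at_top"
        by (rule filterlim_compose[OF exp_at_bot])
    qed simp
    then show "((\<lambda>b. 1 - survival J b) \<longlongrightarrow> 1) at_top"
      by (auto intro!: tendsto_eq_intros)
    show "\<forall>\<^sub>F x in at_top. 1 - survival J x = primitive (\<lambda>s. \<rho> s J * survival J s) x"
      using eventually_ge_at_top[of 0] by eventually_elim (simp add: primitive_rate_survival)
  qed
  ultimately show "(LINT x:{0..}|lborel. \<rho> x J * survival J x) = 1"
    by (rule tendsto_unique[rotated]) simp
qed

definition lifetime :: "real \<Rightarrow> real" where
  "lifetime J = (LINT x:{0..}|lborel. survival J x)"

lemma lifetime_mono: "J \<le> K \<Longrightarrow> lifetime J \<le> lifetime K"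
  unfolding lifetime_def
proof (rule set_integral_mono[OF survival_integrable survival_integrable])
  fix x assume "J \<le> K"
  then have "primitive (\<lambda>s. \<rho> s K) x \<le> primitive (\<lambda>s. \<rho> s J) x"
    using rate_abs rate_antimono by (intro primitive_mono[of _ r\<^sub>M _ r\<^sub>M]) auto
  then show "survival J x \<le> survival K x" by (simp add: survival_def)
qed

lemma lifetime_lower: "1 / r\<^sub>M \<le> lifetime J"
proof -
  have "(LINT x:{0..}|lborel. exp (- r\<^sub>M * x)) \<le> lifetime J"
    unfolding lifetime_def
    using exp_decay_integral(1)[OF rate_max_pos] survival_integrable survival_bounds
    by (intro set_integral_mono) auto
  then show ?thesis using exp_decay_integral(2)[OF rate_max_pos] by simp
qed

lemma survival_tendsto:
  assumes "X \<longlonglongrightarrow> J"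
  shows "(\<lambda>n. survival (X n) x) \<longlonglongrightarrow> survival J x"
proof -
  have "(\<lambda>n. primitive (\<lambda>s. \<rho> s (X n)) x) \<longlonglongrightarrow> primitive (\<lambda>s. \<rho> s J) x"
    unfolding primitive_def set_lebesgue_integral_def
  proof (rule integral_dominated_convergence[where w = "\<lambda>s. indicator {0..x} s * r\<^sub>M"])
    show "integrable lborel (\<lambda>s. indicator {0..x} s * r\<^sub>M)"
      using set_integrable_bounded[of "\<lambda>_. r\<^sub>M" "r\<^sub>M" 0 x] rate_max_pos
      by (simp add: set_integrable_def)
    show "AE s in lborel. (\<lambda>n. indicator {0..x} s *\<^sub>R \<rho> s (X n)) \<longlonglongrightarrow> indicator {0..x} s *\<^sub>R \<rho> s J"
      using isCont_tendsto_compose[OF rate_cont assms] by (intro AE_I2 tendsto_intros) auto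
    show "AE s in lborel. norm (indicator {0..x} s *\<^sub>R \<rho> s (X n)) \<le> indicator {0..x} s * r\<^sub>M" for n
      using rate_abs by (intro AE_I2) (auto simp: indicator_def)
  qed measurable
  then show ?thesis
    unfolding survival_def by (intro tendsto_intros)
qed

lemma lifetime_continuous: "isCont lifetime J"
proof (unfold continuous_at_sequentially, intro allI impI)
  fix X assume X: "X \<longlonglongrightarrow> J"
  show "(lifetime \<circ> X) \<longlonglongrightarrow> lifetime J"
    unfolding lifetime_def comp_def set_lebesgue_integral_def
  proof (rule integral_dominated_convergence[where w = "\<lambda>x. indicator {0..} x *\<^sub>R exp (- r\<^sub>0 * x)"])
    show "integrable lborel (\<lambda>x. indicator {0..} x *\<^sub>R exp (- r\<^sub>0 * x))"
      using exp_decay_integral(1)[OF rate_lower_pos] by (simp add: set_integrable_def)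
    show "AE x in lborel. (\<lambda>n. indicator {0..} x *\<^sub>R survival (X n) x) \<longlonglongrightarrow> indicator {0..} x *\<^sub>R survival J x"
      using survival_tendsto[OF X] by (intro AE_I2 tendsto_intros)
    show "AE x in lborel. norm (indicator {0..} x *\<^sub>R survival (X n) x) \<le> indicator {0..} x *\<^sub>R exp (- r\<^sub>0 * x)" for n
      using survival_bounds(2) survival_nonneg by (intro AE_I2) (auto simp: indicator_def)
  qed measurable
qed

text \<open>
  \<open>J \<cdot> lifetime J\<close> vanishes at \<open>0\<close>, is at least \<open>1\<close> at \<open>r\<^sub>M\<close> by \<open>lifetime_lower\<close>, and is
  strictly increasing because inhibition makes lifetimes longer.
\<close>

lemma equilibrium_activity:
  obtains J where "0 < J" "J \<le> r\<^sub>M" "J * lifetime J = 1" "\<forall>K\<ge>0. K * lifetime K = 1 \<longrightarrow> K = J"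
proof -
  have "\<exists>J\<ge>0. J \<le> r\<^sub>M \<and> J * lifetime J = 1"
  proof (rule IVT')
    show "0 * lifetime 0 \<le> 1" by simp
    show "1 \<le> r\<^sub>M * lifetime r\<^sub>M"
      using lifetime_lower[of r\<^sub>M] rate_max_pos by (simp add: field_simps)
    show "continuous_on {0..r\<^sub>M} (\<lambda>J. J * lifetime J)"
      using lifetime_continuous by (intro continuous_intros continuous_at_imp_continuous_on) auto
  qed (use rate_max_pos in auto)
  then obtain J where J: "0 \<le> J" "J \<le> r\<^sub>M" "J * lifetime J = 1" by blast
  have pos: "lifetime K > 0" for K
    using lifetime_lower[of K] rate_max_pos by (smt (verit) divide_pos_pos)
  have strict: "K * lifetime K < L * lifetime L" if "0 \<le> K" "K < L" for K L
    using that lifetime_mono[of K L] pos[of K] by (intro mult_less_le_imp_less) auto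
  have "J \<noteq> 0" using J by auto
  then have "0 < J" using J by simp
  moreover have "K = J" if "0 \<le> K" "K * lifetime K = 1" for K
    using strict[of K J] strict[of J K] that J by (cases K J rule: linorder_cases) auto
  ultimately show thesis using that J by blast
qed

section \<open>One step of transport\<close>

text \<open>
  Densities on the age half line are extended by \<open>0\<close>, so that shifts in age become shifts of the
  real line.
\<close>

definition density :: "(real \<Rightarrow> real) \<Rightarrow> bool" where
  "density v \<longleftrightarrow> integrable lborel v \<and> (\<forall>x. 0 \<le> v x) \<and> (\<forall>x\<le>0. v x = 0) \<and> (LINT x|lborel. v x) = 1"

text \<open>
  The solution formula over one step of length \<open>h\<close> from the density \<open>v\<close> to \<open>w\<close>, where \<open>K s\<close> is the
  activity at time \<open>s\<close> after the beginning of the step. The two clauses concern the part that was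
  already present and the part that entered through the boundary during the step.
\<close>

definition transported :: "(real \<Rightarrow> real) \<Rightarrow> real \<Rightarrow> (real \<Rightarrow> real) \<Rightarrow> (real \<Rightarrow> real) \<Rightarrow> bool" where
  "transported K h v w \<longleftrightarrow>
     (AE y in lborel. 0 < y \<longrightarrow> w (y + h) = v y * exp (- primitive (\<lambda>s. \<rho> (y + s) (K s)) h)) \<and>
     (AE x in lborel. 0 < x \<and> x < h \<longrightarrow>
        w x = K (h - x) * exp (- primitive (\<lambda>s. \<rho> s (K (h - x + s))) x))"

lemma primitive_rate_bounds:
  assumes [measurable]: "K \<in> borel_measurable borel" and "0 \<le> h"
  shows "0 \<le> primitive (\<lambda>s. \<rho> (y + s) (K (z + s))) h"
    and "primitive (\<lambda>s. \<rho> (y + s) (K (z + s))) h \<le> r\<^sub>M * h"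
proof -
  have m: "(\<lambda>s. \<rho> (y + s) (K (z + s))) \<in> borel_measurable borel" by measurable
  show "0 \<le> primitive (\<lambda>s. \<rho> (y + s) (K (z + s))) h"
    using primitive_bounds(1)[OF m rate_nonneg rate_upper \<open>0 \<le> h\<close>] by simp
  show "primitive (\<lambda>s. \<rho> (y + s) (K (z + s))) h \<le> r\<^sub>M * h"
    using primitive_bounds(2)[OF m rate_nonneg rate_upper \<open>0 \<le> h\<close>] .
qed

lemma transported_near_boundary:
  assumes K: "K \<in> borel_measurable borel" "\<And>s. 0 \<le> K s \<and> K s \<le> r\<^sub>M"
    and "0 \<le> h" and tr: "transported K h v w"
  shows "AE y in lborel. -h < y \<and> y < 0 \<longrightarrow>
    (\<exists>a. 0 \<le> a \<and> a \<le> r\<^sub>M * h \<and> w (y + h) = K (- y) * exp (- a))"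
proof -
  have "AE x in lborel. 0 < x \<and> x < h \<longrightarrow>
        w x = K (h - x) * exp (- primitive (\<lambda>s. \<rho> s (K (h - x + s))) x)"
    using tr by (simp add: transported_def)
  from AE_lborel_shift[OF this, of h] show ?thesis
  proof eventually_elim
    case (elim y)
    show ?case
    proof
      assume y: "- h < y \<and> y < 0"
      define a where "a = primitive (\<lambda>s. \<rho> s (K (h - (y + h) + s))) (y + h)"
      have "0 \<le> a" "a \<le> r\<^sub>M * (y + h)"
        using primitive_rate_bounds[OF K(1), of "y + h" 0 "h - (y + h)"] y by (auto simp: a_def)
      moreover have "r\<^sub>M * (y + h) \<le> r\<^sub>M * h"
        using y rate_max_pos by simp
      ultimately show "\<exists>a. 0 \<le> a \<and> a \<le> r\<^sub>M * h \<and> w (y + h) = K (- y) * exp (- a)"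
        using elim y by (intro exI[of _ a]) (auto simp: a_def)
    qed
  qed
qed

lemma integrable_rate_mult:
  assumes [measurable]: "g \<in> borel_measurable borel" "f \<in> borel_measurable borel" and v: "integrable lborel v"
  shows "integrable lborel (\<lambda>y. \<rho> (f y) (g y) * v y)"
proof (rule Bochner_Integration.integrable_bound[where f = "\<lambda>y. r\<^sub>M * v y"])
  show "integrable lborel (\<lambda>y. r\<^sub>M * v y)" using v by simp
  have [measurable]: "v \<in> borel_measurable borel" using borel_measurable_integrable[OF v] by simp
  show "(\<lambda>y. \<rho> (f y) (g y) * v y) \<in> borel_measurable lborel" by measurable
  show "AE y in lborel. norm (\<rho> (f y) (g y) * v y) \<le> norm (r\<^sub>M * v y)"
    using rate_abs rate_max_pos by (intro AE_I2) (auto simp: abs_mult intro!: mult_right_mono)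
qed

text \<open>
  The activity at the end of a step is read off from the density at its beginning, up to an error
  linear in \<open>h\<close>: survivors lose at most the fraction \<open>r\<^sub>M h\<close>, and the newcomers have ages in
  \<open>(0, h)\<close> and density at most \<open>r\<^sub>M\<close>. The two errors have opposite signs, and each one
  contributes at most \<open>r\<^sub>M\<^sup>2 h\<close>.
\<close>

lemma activity_from_earlier_density:
  assumes K: "K \<in> borel_measurable borel" "\<And>s. 0 \<le> K s \<and> K s \<le> r\<^sub>M"
    and h: "0 \<le> h" and v: "density v" and w: "density w" and tr: "transported K h v w"
    and act: "K h = (LINT x|lborel. \<rho> x (K h) * w x)"
  shows "\<bar>K h - (LINT y|lborel. \<rho> (y + h) (K h) * v y)\<bar> \<le> r\<^sub>M\<^sup>2 * h"
proof -
  define I where "I = (LINT y|lborel. \<rho> (y + h) (K h) * v y)"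
  have vi: "integrable lborel v" "\<And>x. 0 \<le> v x" "\<And>x. x \<le> 0 \<Longrightarrow> v x = 0" "(LINT x|lborel. v x) = 1"
    using v by (auto simp: density_def)
  have wi: "integrable lborel w" "\<And>x. 0 \<le> w x" "\<And>x. x \<le> 0 \<Longrightarrow> w x = 0"
    using w by (auto simp: density_def)
  have int_v: "integrable lborel (\<lambda>y. \<rho> (y + h) (K h) * v y)"
    by (intro integrable_rate_mult vi) measurable
  have int_w: "integrable lborel (\<lambda>x. \<rho> x (K h) * w x)"
    by (intro integrable_rate_mult wi) measurable
  have Kh: "K h = (LINT y|lborel. \<rho> (y + h) (K h) * w (y + h))"
    using act lborel_integral_shift(1)[of "\<lambda>x. \<rho> x (K h) * w x" h] by simp
  have int_w': "integrable lborel (\<lambda>y. \<rho> (y + h) (K h) * w (y + h))"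
    using lborel_integral_shift(2)[OF int_w] .
  have int_ind: "integrable lborel (indicat_real {-h..0})"
    by (intro integrable_real_indicator) (auto simp: emeasure_lborel_Icc_eq)
  have ind: "(LINT y|lborel. indicat_real {-h..0} y) = h"
    using h by simp
  have tr1: "AE y in lborel. 0 < y \<longrightarrow> w (y + h) = v y * exp (- primitive (\<lambda>s. \<rho> (y + s) (K s)) h)"
    using tr by (simp add: transported_def)
  note E = primitive_rate_bounds[OF K(1) h, of _ 0, simplified]
  note bdry = transported_near_boundary[OF K h tr]
  have not0: "AE y in lborel. y \<noteq> - h" "AE y in lborel. y \<noteq> (0::real)"
    by (rule AE_lborel_singleton)+
  have upper: "AE y in lborel. \<rho> (y + h) (K h) * w (y + h)
      \<le> \<rho> (y + h) (K h) * v y + r\<^sub>M\<^sup>2 * indicator {-h..0} y"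
    using tr1 bdry not0
  proof eventually_elim
    case (elim y)
    consider "0 < y" | "-h < y" "y < 0" | "y < - h" using elim by linarith
    then show ?case
    proof cases
      case 1
      have "w (y + h) \<le> v y" using elim 1 E(1)[of y] vi(2)[of y] by (simp add: mult_left_le)
      then have "\<rho> (y + h) (K h) * w (y + h) \<le> \<rho> (y + h) (K h) * v y"
        by (intro mult_left_mono rate_nonneg)
      then show ?thesis by (simp add: add_increasing2)
    next
      case 2
      then obtain a where a: "0 \<le> a" "w (y + h) = K (- y) * exp (- a)" using elim by blast
      then have "w (y + h) \<le> r\<^sub>M * 1"
        using mult_mono[of "K (- y)" r\<^sub>M "exp (- a)" 1] K(2)[of "- y"] rate_max_pos by simp
      then have "\<rho> (y + h) (K h) * w (y + h) \<le> r\<^sub>M * r\<^sub>M"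
        using rate_upper wi(2) rate_max_pos by (intro mult_mono) auto
      then show ?thesis using 2 vi(3)[of y] by (simp add: power2_eq_square)
    next
      case 3
      then show ?thesis using wi(3)[of "y + h"] vi(3)[of y] h by simp
    qed
  qed
  have lower: "AE y in lborel. (1 - r\<^sub>M * h) * (\<rho> (y + h) (K h) * v y) \<le> \<rho> (y + h) (K h) * w (y + h)"
    using tr1
  proof eventually_elim
    case (elim y)
    show ?case
    proof (cases "0 < y")
      case True
      have "1 - r\<^sub>M * h \<le> exp (- primitive (\<lambda>s. \<rho> (y + s) (K s)) h)"
        using E[of y] exp_ge_add_one_self[of "- primitive (\<lambda>s. \<rho> (y + s) (K s)) h"] by linarith
      then have "(1 - r\<^sub>M * h) * v y \<le> exp (- primitive (\<lambda>s. \<rho> (y + s) (K s)) h) * v y"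
        using vi(2) by (intro mult_right_mono)
      then have "(1 - r\<^sub>M * h) * v y \<le> w (y + h)"
        using elim True by (simp add: mult.commute)
      then have "\<rho> (y + h) (K h) * ((1 - r\<^sub>M * h) * v y) \<le> \<rho> (y + h) (K h) * w (y + h)"
        by (intro mult_left_mono rate_nonneg)
      then show ?thesis by (simp add: algebra_simps)
    next
      case False
      then show ?thesis using vi(3)[of y] wi(2) rate_nonneg by simp
    qed
  qed
  have "K h \<le> (LINT y|lborel. \<rho> (y + h) (K h) * v y + r\<^sub>M\<^sup>2 * indicator {-h..0} y)"
    by (subst Kh) (intro integral_mono_AE upper int_w' Bochner_Integration.integrable_add int_v integrable_mult_right int_ind)
  also have "\<dots> = I + r\<^sub>M\<^sup>2 * h"
    using int_v int_ind ind by (subst Bochner_Integration.integral_add) (auto simp: I_def)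
  finally have up: "K h \<le> I + r\<^sub>M\<^sup>2 * h" .
  have "(LINT y|lborel. (1 - r\<^sub>M * h) * (\<rho> (y + h) (K h) * v y)) \<le> K h"
    by (rule order_trans[OF _ eq_refl[OF Kh[symmetric]]])
       (intro integral_mono_AE lower int_w' integrable_mult_right int_v)
  then have "(1 - r\<^sub>M * h) * I \<le> K h"
    by (simp add: I_def)
  moreover have "I \<le> r\<^sub>M"
  proof -
    have "I \<le> (LINT y|lborel. r\<^sub>M * v y)"
      unfolding I_def using rate_upper vi by (intro integral_mono int_v) (auto intro!: mult_right_mono)
    then show ?thesis using vi by simp
  qed
  then have "r\<^sub>M * h * I \<le> r\<^sub>M * h * r\<^sub>M"
    using h rate_max_pos by (intro mult_left_mono) auto
  ultimately have "I - r\<^sub>M\<^sup>2 * h \<le> K h"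
    by (simp add: algebra_simps power2_eq_square)
  then show ?thesis using up by (simp add: I_def abs_le_iff)
qed

text \<open>
  The heart of the matter. Let \<open>\<sigma>\<close> be the sign of \<open>c - J\<close>. By monotonicity,
  \<open>\<bar>\<rho>(\<cdot>, c) - \<rho>(\<cdot>, J)\<bar> = \<sigma> (\<rho>(\<cdot>, J) - \<rho>(\<cdot>, c))\<close>, so the two approximate equations for \<open>c\<close> and
  \<open>J\<close> turn \<open>\<bar>c - J\<bar> + \<integral>\<bar>\<rho>(\<cdot>, c) - \<rho>(\<cdot>, J)\<bar> \<nu>\<close> into \<open>\<sigma> \<integral>\<rho>(\<cdot>, c) (v - \<nu>)\<close>,
  up to \<open>2 \<epsilon>\<close>. Because \<open>v - \<nu>\<close> has
  integral \<open>0\<close>, the constant \<open>r\<^sub>0\<close> can be subtracted from \<open>\<rho>\<close> there, which leaves the surplus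
  \<open>r\<^sub>0 \<parallel>v - \<nu>\<parallel>\<close> when compared with \<open>\<integral>\<rho>(\<cdot>, c) \<bar>v - \<nu>\<bar>\<close>. Ages are shifted by \<open>s\<close> since \<open>v\<close> is the
  density at an earlier time.
\<close>

lemma inhibition_cancellation:
  assumes v: "density v" and \<nu>: "density \<nu>"
    and c: "\<bar>c - (LINT y|lborel. \<rho> (y + s) c * v y)\<bar> \<le> \<epsilon>"
    and J: "\<bar>J - (LINT y|lborel. \<rho> (y + s) J * \<nu> y)\<bar> \<le> \<epsilon>"
  shows "(LINT y|lborel. \<bar>\<rho> (y + s) c - \<rho> (y + s) J\<bar> * \<nu> y - \<rho> (y + s) c * \<bar>v y - \<nu> y\<bar>)
         \<le> 2 * \<epsilon> - r\<^sub>0 * (LINT y|lborel. \<bar>v y - \<nu> y\<bar>) - \<bar>c - J\<bar>"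
proof -
  define \<sigma> :: real where "\<sigma> = (if J \<le> c then 1 else -1)"
  have s1: "\<sigma> * (c - J) = \<bar>c - J\<bar>" "\<bar>\<sigma>\<bar> = 1" by (auto simp: \<sigma>_def)
  have s2: "\<bar>\<rho> (y + s) c - \<rho> (y + s) J\<bar> = \<sigma> * (\<rho> (y + s) J - \<rho> (y + s) c)" for y
    using rate_antimono[of J c "y + s"] rate_antimono[of c J "y + s"] by (auto simp: \<sigma>_def)
  have vi: "integrable lborel v" "(LINT x|lborel. v x) = 1"
    and ni: "integrable lborel \<nu>" "(LINT x|lborel. \<nu> x) = 1"
    using v \<nu> by (auto simp: density_def)
  have mi: "integrable lborel (\<lambda>y. \<bar>v y - \<nu> y\<bar>)" "integrable lborel (\<lambda>y. v y - \<nu> y)"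
    using vi ni by auto
  have i1: "integrable lborel (\<lambda>y. \<rho> (y + s) c * v y)"
    and i2: "integrable lborel (\<lambda>y. \<rho> (y + s) J * \<nu> y)"
    and i3: "integrable lborel (\<lambda>y. \<rho> (y + s) c * \<nu> y)"
    and i4: "integrable lborel (\<lambda>y. \<rho> (y + s) c * \<bar>v y - \<nu> y\<bar>)"
    by (intro integrable_rate_mult vi ni mi; measurable)+
  have "(LINT y|lborel. \<bar>\<rho> (y + s) c - \<rho> (y + s) J\<bar> * \<nu> y - \<rho> (y + s) c * \<bar>v y - \<nu> y\<bar>)
      = (LINT y|lborel. \<sigma> * (\<rho> (y + s) J * \<nu> y) - \<sigma> * (\<rho> (y + s) c * \<nu> y) - \<rho> (y + s) c * \<bar>v y - \<nu> y\<bar>)"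
    by (intro Bochner_Integration.integral_cong) (auto simp: s2 algebra_simps)
  also have "\<dots> = \<sigma> * (LINT y|lborel. \<rho> (y + s) J * \<nu> y) - \<sigma> * (LINT y|lborel. \<rho> (y + s) c * \<nu> y)
       - (LINT y|lborel. \<rho> (y + s) c * \<bar>v y - \<nu> y\<bar>)"
    using i2 i3 i4 by simp
  also have "\<dots> \<le> \<sigma> * (LINT y|lborel. \<rho> (y + s) c * v y) - \<sigma> * (LINT y|lborel. \<rho> (y + s) c * \<nu> y)
       - (LINT y|lborel. \<rho> (y + s) c * \<bar>v y - \<nu> y\<bar>) + 2 * \<epsilon> - \<bar>c - J\<bar>"
    using c J by (auto simp: \<sigma>_def)
  also have "\<sigma> * (LINT y|lborel. \<rho> (y + s) c * v y) - \<sigma> * (LINT y|lborel. \<rho> (y + s) c * \<nu> y)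
       - (LINT y|lborel. \<rho> (y + s) c * \<bar>v y - \<nu> y\<bar>)
     = (LINT y|lborel. \<sigma> * (\<rho> (y + s) c * v y) - \<sigma> * (\<rho> (y + s) c * \<nu> y) - \<rho> (y + s) c * \<bar>v y - \<nu> y\<bar>)"
    using i1 i3 i4 by simp
  also have "\<dots> \<le> (LINT y|lborel. \<sigma> * r\<^sub>0 * (v y - \<nu> y) - r\<^sub>0 * \<bar>v y - \<nu> y\<bar>)"
  proof (intro integral_mono)
    fix y
    have "\<sigma> * (v y - \<nu> y) \<le> \<bar>v y - \<nu> y\<bar>" by (auto simp: \<sigma>_def)
    then have "(\<rho> (y + s) c - r\<^sub>0) * (\<sigma> * (v y - \<nu> y)) \<le> (\<rho> (y + s) c - r\<^sub>0) * \<bar>v y - \<nu> y\<bar>"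
      using rate_lower[of "y + s" c] by (intro mult_left_mono) auto
    then show "\<sigma> * (\<rho> (y + s) c * v y) - \<sigma> * (\<rho> (y + s) c * \<nu> y) - \<rho> (y + s) c * \<bar>v y - \<nu> y\<bar>
        \<le> \<sigma> * r\<^sub>0 * (v y - \<nu> y) - r\<^sub>0 * \<bar>v y - \<nu> y\<bar>"
      by (simp add: algebra_simps)
  qed (use i1 i3 i4 mi in auto)
  also have "\<dots> = - r\<^sub>0 * (LINT y|lborel. \<bar>v y - \<nu> y\<bar>)"
    using mi vi ni by simp
  finally show ?thesis by simp
qed

text \<open>
  The cancellation holds at each time with all ages together, while the hazards accumulate in time
  at each age; exchanging the integrals connects the two.
\<close>

lemma Fubini_time_age:
  fixes K v \<nu> :: "real \<Rightarrow> real" and h J :: real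
  assumes K: "K \<in> borel_measurable borel" and v: "integrable lborel v" and \<nu>: "integrable lborel \<nu>"
    and h: "0 \<le> h"
  defines "\<Psi> \<equiv> \<lambda>s y. \<bar>\<rho> (y + s) (K s) - \<rho> (y + s) J\<bar> * \<nu> y - \<rho> (y + s) (K s) * \<bar>v y - \<nu> y\<bar>"
  shows "integrable lborel (\<lambda>y. \<nu> y * primitive (\<lambda>s. \<bar>\<rho> (y + s) (K s) - \<rho> (y + s) J\<bar>) h
            - \<bar>v y - \<nu> y\<bar> * primitive (\<lambda>s. \<rho> (y + s) (K s)) h)" (is "integrable lborel ?G")
    and "integrable lborel (\<lambda>s. indicator {0..h} s * (LINT y|lborel. \<Psi> s y))"
    and "(LINT y|lborel. \<nu> y * primitive (\<lambda>s. \<bar>\<rho> (y + s) (K s) - \<rho> (y + s) J\<bar>) h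
            - \<bar>v y - \<nu> y\<bar> * primitive (\<lambda>s. \<rho> (y + s) (K s)) h)
       = (LINT s|lborel. indicator {0..h} s * (LINT y|lborel. \<Psi> s y))"
proof -
  note [measurable] = K
  have [measurable]: "v \<in> borel_measurable borel" "\<nu> \<in> borel_measurable borel"
    using v \<nu> by auto
  define g where "g y = r\<^sub>M * (\<bar>\<nu> y\<bar> + \<bar>v y - \<nu> y\<bar>)" for y
  have g: "integrable lborel g" unfolding g_def using v \<nu> by auto
  have bound: "\<bar>\<Psi> s y\<bar> \<le> g y" for s y
  proof -
    have "\<bar>\<rho> (y + s) (K s) - \<rho> (y + s) J\<bar> \<le> r\<^sub>M"
      using rate_upper[of "y + s"] rate_nonneg[of "y + s"] by (smt (verit))
    then have "\<bar>\<bar>\<rho> (y + s) (K s) - \<rho> (y + s) J\<bar> * \<nu> y\<bar> \<le> r\<^sub>M * \<bar>\<nu> y\<bar>"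
      by (simp add: abs_mult mult_right_mono)
    moreover have "\<bar>\<rho> (y + s) (K s) * \<bar>v y - \<nu> y\<bar>\<bar> \<le> r\<^sub>M * \<bar>v y - \<nu> y\<bar>"
      using rate_abs by (simp add: abs_mult mult_right_mono)
    ultimately show ?thesis unfolding \<Psi>_def g_def by (simp add: algebra_simps abs_le_iff)
  qed
  have meas: "(\<lambda>(s, y). indicator {0..h} s * \<Psi> s y) \<in> borel_measurable (lborel \<Otimes>\<^sub>M lborel)"
    unfolding \<Psi>_def by measurable
  have dom: "integrable (lborel \<Otimes>\<^sub>M lborel) (\<lambda>(s, y). indicator {0..h} s * g y)"
  proof (rule lborel_pair.Fubini_integrable)
    show "(\<lambda>(s, y). indicator {0..h} s * g y) \<in> borel_measurable (lborel \<Otimes>\<^sub>M lborel)"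
      unfolding g_def by measurable
    have "integrable lborel (indicat_real {0..h})"
      by (intro integrable_real_indicator) (auto simp: emeasure_lborel_Icc_eq)
    then have "integrable lborel (\<lambda>s. indicator {0..h} s * (LINT y|lborel. \<bar>g y\<bar>))"
      by simp
    then show "integrable lborel (\<lambda>s. LINT y|lborel. norm (case (s, y) of (s, y) \<Rightarrow> indicator {0..h} s * g y))"
      by (simp add: abs_mult)
    show "AE s in lborel. integrable lborel (\<lambda>y. case (s, y) of (s, y) \<Rightarrow> indicator {0..h} s * g y)"
      using g by simp
  qed
  have int2: "integrable (lborel \<Otimes>\<^sub>M lborel) (\<lambda>(s, y). indicator {0..h} s * \<Psi> s y)"
  proof (rule Bochner_Integration.integrable_bound[OF dom meas], rule AE_I2)
    fix z :: "real \<times> real"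
    obtain s y where "z = (s, y)" by (cases z)
    then show "norm (case z of (s, y) \<Rightarrow> indicator {0..h} s * \<Psi> s y)
        \<le> norm (case z of (s, y) \<Rightarrow> indicator {0..h} s * g y)"
      using bound[of s y] by (auto simp: indicator_def)
  qed
  have inner: "(LINT s|lborel. indicator {0..h} s * \<Psi> s y) = ?G y" for y
  proof -
    have m1: "(\<lambda>s. \<bar>\<rho> (y + s) (K s) - \<rho> (y + s) J\<bar>) \<in> borel_measurable borel"
      and m2: "(\<lambda>s. \<rho> (y + s) (K s)) \<in> borel_measurable borel"
      by measurable
    have b1: "\<bar>\<bar>\<rho> (y + s) (K s) - \<rho> (y + s) J\<bar>\<bar> \<le> r\<^sub>M" for s
      using rate_upper[of "y + s"] rate_nonneg[of "y + s"] by (smt (verit))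
    have i1: "set_integrable lborel {0..h} (\<lambda>s. \<bar>\<rho> (y + s) (K s) - \<rho> (y + s) J\<bar>)"
      and i2: "set_integrable lborel {0..h} (\<lambda>s. \<rho> (y + s) (K s))"
      using set_integrable_bounded[OF m1 b1] set_integrable_bounded[OF m2 rate_abs] by auto
    have "(LINT s|lborel. indicator {0..h} s * \<Psi> s y)
        = (LINT s|lborel. (indicator {0..h} s * \<bar>\<rho> (y + s) (K s) - \<rho> (y + s) J\<bar>) * \<nu> y
            - (indicator {0..h} s * \<rho> (y + s) (K s)) * \<bar>v y - \<nu> y\<bar>)"
      by (intro Bochner_Integration.integral_cong) (auto simp: \<Psi>_def algebra_simps)
    also have "\<dots> = ?G y"
      using i1 i2 unfolding set_integrable_def primitive_def set_lebesgue_integral_def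
      by (simp add: mult.commute)
    finally show ?thesis .
  qed
  show "integrable lborel ?G"
    using lborel_pair.integrable_snd[OF int2] by (simp add: inner)
  show "integrable lborel (\<lambda>s. indicator {0..h} s * (LINT y|lborel. \<Psi> s y))"
    using lborel_pair.integrable_fst[OF int2] by simp
  show "(LINT y|lborel. ?G y) = (LINT s|lborel. indicator {0..h} s * (LINT y|lborel. \<Psi> s y))"
    using lborel_pair.integral_fst[OF int2] lborel_pair.integral_snd[OF int2] by (simp add: inner)
qed

text \<open>
  The distance after the step is bounded pointwise along characteristics by first order
  expressions in the accumulated hazards; integrating in age and exchanging the order of
  integration leaves, at each time \<open>s\<close> of the step, the quantity estimated by
  \<open>inhibition_cancellation\<close>. The newcomers contribute \<open>\<integral>\<bar>K s - J\<bar> ds\<close>, which cancels against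
  the same term there. The constant is \<open>4 = 1 + 1 + 2\<close>: second order terms of the exponential
  (using \<open>\<parallel>v - \<nu>\<parallel> \<le> 2\<close>), mortality of the newcomers, and the error \<open>r\<^sub>M\<^sup>2 h\<close> in the activities of
  both \<open>v\<close> and \<open>\<nu>\<close>.
\<close>

lemma one_step_contraction:
  assumes K: "K \<in> borel_measurable borel" "\<And>s. 0 \<le> K s \<and> K s \<le> r\<^sub>M"
    and J: "0 \<le> J" "J \<le> r\<^sub>M"
    and h: "0 \<le> h" and v: "density (v 0)" and \<nu>: "density \<nu>"
    and w: "\<And>s. 0 \<le> s \<Longrightarrow> s \<le> h \<Longrightarrow> density (v s)"
    and tr: "\<And>s. 0 \<le> s \<Longrightarrow> s \<le> h \<Longrightarrow> transported K s (v 0) (v s)"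
    and act: "\<And>s. 0 \<le> s \<Longrightarrow> s \<le> h \<Longrightarrow> K s = (LINT x|lborel. \<rho> x (K s) * v s x)"
    and tr\<nu>: "\<And>s. 0 \<le> s \<Longrightarrow> s \<le> h \<Longrightarrow> transported (\<lambda>_. J) s \<nu> \<nu>"
    and actJ: "J = (LINT x|lborel. \<rho> x J * \<nu> x)"
  shows "(LINT x|lborel. \<bar>v h x - \<nu> x\<bar>) \<le> (1 - r\<^sub>0 * h) * (LINT x|lborel. \<bar>v 0 x - \<nu> x\<bar>) + 4 * r\<^sub>M\<^sup>2 * h\<^sup>2"
proof -
  note [measurable] = K(1)
  define u where "u = (LINT x|lborel. \<bar>v 0 x - \<nu> x\<bar>)"
  define \<Psi> where "\<Psi> s y = \<bar>\<rho> (y + s) (K s) - \<rho> (y + s) J\<bar> * \<nu> y - \<rho> (y + s) (K s) * \<bar>v 0 y - \<nu> y\<bar>" for s y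
  define A where "A y = primitive (\<lambda>s. \<rho> (y + s) (K s)) h" for y
  define B where "B y = primitive (\<lambda>s. \<rho> (y + s) J) h" for y
  define D where "D y = primitive (\<lambda>s. \<bar>\<rho> (y + s) (K s) - \<rho> (y + s) J\<bar>) h" for y
  have v0: "integrable lborel (v 0)" "\<And>x. 0 \<le> v 0 x" "\<And>x. x \<le> 0 \<Longrightarrow> v 0 x = 0" "(LINT x|lborel. v 0 x) = 1"
    using v by (auto simp: density_def)
  have vh: "integrable lborel (v h)" "\<And>x. x \<le> 0 \<Longrightarrow> v h x = 0"
    using w[of h] h by (auto simp: density_def)
  have n0: "integrable lborel \<nu>" "\<And>x. 0 \<le> \<nu> x" "\<And>x. x \<le> 0 \<Longrightarrow> \<nu> x = 0" "(LINT x|lborel. \<nu> x) = 1"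
    using \<nu> by (auto simp: density_def)
  have mi: "integrable lborel (\<lambda>y. \<bar>v 0 y - \<nu> y\<bar>)"
    using v0 n0 by auto
  have u2: "u \<le> 2"
  proof -
    have "u \<le> (LINT x|lborel. v 0 x + \<nu> x)"
      unfolding u_def
    proof (rule integral_mono)
      show "\<bar>v 0 x - \<nu> x\<bar> \<le> v 0 x + \<nu> x" for x using v0(2)[of x] n0(2)[of x] by linarith
    qed (use mi v0 n0 in auto)
    then show ?thesis using v0 n0 by simp
  qed
  have AB: "0 \<le> A y" "A y \<le> r\<^sub>M * h" "0 \<le> B y" for y
    using primitive_rate_bounds[OF K(1) h, of y 0] primitive_rate_bounds[OF _ h, of "\<lambda>_. J" y 0]
    by (auto simp: A_def B_def)
  have ABD: "\<bar>A y - B y\<bar> \<le> D y" for y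
  proof -
    have m: "(\<lambda>s. \<rho> (y + s) (K s)) \<in> borel_measurable borel" "(\<lambda>s. \<rho> (y + s) J) \<in> borel_measurable borel"
      by measurable
    note i = set_integrable_bounded[OF m(1) rate_abs, of 0 h] set_integrable_bounded[OF m(2) rate_abs, of 0 h]
    have "A y - B y = (LINT s:{0..h}|lborel. \<rho> (y + s) (K s) - \<rho> (y + s) J)"
      unfolding A_def B_def primitive_def using i by (simp add: set_integral_diff)
    also have "\<bar>\<dots>\<bar> \<le> D y"
      unfolding D_def primitive_def set_lebesgue_integral_def
      using integral_norm_bound[of lborel "\<lambda>s. indicat_real {0..h} s *\<^sub>R (\<rho> (y + s) (K s) - \<rho> (y + s) J)"]
      by (simp add: abs_mult)
    finally show ?thesis .
  qed
  note Fub = Fubini_time_age[OF K(1) v0(1) n0(1) h, of J, folded \<Psi>_def A_def D_def]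
  have int_ind: "integrable lborel (indicat_real {0..h})" "integrable lborel (indicat_real {-h..0})"
    by (intro integrable_real_indicator; auto simp: emeasure_lborel_Icc_eq)+
  have ind: "(LINT y|lborel. indicat_real {0..h} y) = h" "(LINT y|lborel. indicat_real {-h..0} y) = h"
    using h by auto
  define q where "q s = indicat_real {0..h} s * \<bar>K s - J\<bar>" for s
  have q: "integrable lborel q"
  proof -
    have "\<bar>\<bar>K s - J\<bar>\<bar> \<le> r\<^sub>M" for s using K(2)[of s] J by auto
    then have "set_integrable lborel {0..h} (\<lambda>s. \<bar>K s - J\<bar>)"
      by (intro set_integrable_bounded) measurable
    then show ?thesis by (simp add: set_integrable_def q_def[abs_def])
  qed
  have q': "integrable lborel (\<lambda>y. q (- y))" "(LINT y|lborel. q (- y)) = (LINT s|lborel. q s)"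
    using lborel_integrable_real_affine[OF q, of "-1" 0] lborel_integral_real_affine[of "-1" q 0] by auto

  \<comment> \<open>At \<open>y > 0\<close> this follows the characteristic that starts at age \<open>y\<close>; at \<open>-h < y < 0\<close> it
     concerns the newcomers that enter at time \<open>-y\<close>, whence \<open>q (- y)\<close>.\<close>
  have pw: "AE y in lborel. \<bar>v h (y + h) - \<nu> (y + h)\<bar>
      \<le> \<bar>v 0 y - \<nu> y\<bar> * (1 + r\<^sub>M\<^sup>2 * h\<^sup>2 / 2) + (\<nu> y * D y - \<bar>v 0 y - \<nu> y\<bar> * A y)
        + (q (- y) + r\<^sub>M\<^sup>2 * h * indicator {-h..0} y)"
  proof -
    have 1: "AE y in lborel. 0 < y \<longrightarrow> v h (y + h) = v 0 y * exp (- A y)"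
      and 2: "AE y in lborel. 0 < y \<longrightarrow> \<nu> (y + h) = \<nu> y * exp (- B y)"
      using tr[of h] tr\<nu>[of h] h by (auto simp: transported_def A_def B_def)
    have 3: "AE y in lborel. -h < y \<and> y < 0 \<longrightarrow>
        (\<exists>a. 0 \<le> a \<and> a \<le> r\<^sub>M * h \<and> v h (y + h) = K (- y) * exp (- a))"
      using tr[of h] h by (intro transported_near_boundary K) auto
    have 4: "AE y in lborel. -h < y \<and> y < 0 \<longrightarrow>
        (\<exists>a. 0 \<le> a \<and> a \<le> r\<^sub>M * h \<and> \<nu> (y + h) = J * exp (- a))"
      using tr\<nu>[of h] h J by (intro transported_near_boundary[of "\<lambda>_. J"]) auto
    have not0: "AE y in lborel. y \<noteq> - h" "AE y in lborel. y \<noteq> (0::real)"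
      by (rule AE_lborel_singleton)+
    from 1 2 3 4 not0 show ?thesis
    proof eventually_elim
      case (elim y)
      consider "0 < y" | "-h < y" "y < 0" | "y < - h" using elim by linarith
      then show ?case
      proof cases
        case 1
        have "\<bar>v h (y + h) - \<nu> (y + h)\<bar> \<le> \<bar>v 0 y - \<nu> y\<bar> * (1 - A y + (A y)\<^sup>2 / 2) + \<nu> y * \<bar>A y - B y\<bar>"
          using elim 1 AB n0(2)[of y] decay_difference_bound[of "A y" "B y" "\<nu> y" "v 0 y"] by simp
        also have "\<dots> \<le> \<bar>v 0 y - \<nu> y\<bar> * (1 - A y + (r\<^sub>M * h)\<^sup>2 / 2) + \<nu> y * D y"
          using AB[of y] ABD[of y] n0(2)[of y] power_mono[of "A y" "r\<^sub>M * h" 2]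
          by (intro add_mono mult_left_mono) auto
        finally show ?thesis
          using 1 by (simp add: algebra_simps power_mult_distrib q_def)
      next
        case 2
        then obtain a b where ab: "0 \<le> a" "a \<le> r\<^sub>M * h" "v h (y + h) = K (- y) * exp (- a)"
          "0 \<le> b" "b \<le> r\<^sub>M * h" "\<nu> (y + h) = J * exp (- b)" using elim by auto
        have "\<bar>v h (y + h) - \<nu> (y + h)\<bar> \<le> \<bar>K (- y) - J\<bar> + r\<^sub>M * (r\<^sub>M * h)"
        proof -
          have ea: "exp (- a) \<le> 1" "exp (- b) \<le> 1" "1 - r\<^sub>M * h \<le> exp (- a)" "1 - r\<^sub>M * h \<le> exp (- b)"
            using ab exp_ge_add_one_self[of "- a"] exp_ge_add_one_self[of "- b"] by auto
          have "K (- y) * exp (- a) - J * exp (- b) = (K (- y) - J) * exp (- a) + J * (exp (- a) - exp (- b))"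
            by (simp add: algebra_simps)
          then have "\<bar>K (- y) * exp (- a) - J * exp (- b)\<bar> \<le> \<bar>K (- y) - J\<bar> * exp (- a) + J * \<bar>exp (- a) - exp (- b)\<bar>"
            using J by (metis abs_exp_cancel abs_mult abs_of_nonneg abs_triangle_ineq)
          moreover have "\<bar>exp (- a) - exp (- b)\<bar> \<le> r\<^sub>M * h"
            using ea by linarith
          then have "\<bar>K (- y) - J\<bar> * exp (- a) + J * \<bar>exp (- a) - exp (- b)\<bar>
              \<le> \<bar>K (- y) - J\<bar> * 1 + r\<^sub>M * (r\<^sub>M * h)"
            using ea J rate_max_pos by (intro add_mono mult_mono) auto
          ultimately show ?thesis using ab by simp
        qed
        then show ?thesis
          using 2 v0(3)[of y] n0(3)[of y] by (simp add: q_def power2_eq_square)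
      next
        case 3
        then show ?thesis using vh(2)[of "y + h"] v0(3)[of y] n0(3)[of y] n0(3)[of "y + h"] h
          by (simp add: q_def)
      qed
    qed
  qed
  have "(LINT x|lborel. \<bar>v h x - \<nu> x\<bar>) = (LINT y|lborel. \<bar>v h (y + h) - \<nu> (y + h)\<bar>)"
    using lborel_integral_shift(1)[of "\<lambda>x. \<bar>v h x - \<nu> x\<bar>" h] by simp
  also have "\<dots> \<le> (LINT y|lborel. \<bar>v 0 y - \<nu> y\<bar> * (1 + r\<^sub>M\<^sup>2 * h\<^sup>2 / 2) + (\<nu> y * D y - \<bar>v 0 y - \<nu> y\<bar> * A y)
        + (q (- y) + r\<^sub>M\<^sup>2 * h * indicator {-h..0} y))"
    using pw
  proof (rule integral_mono_AE[rotated 2])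
    show "integrable lborel (\<lambda>y. \<bar>v h (y + h) - \<nu> (y + h)\<bar>)"
      using lborel_integral_shift(2)[of "\<lambda>x. \<bar>v h x - \<nu> x\<bar>" h] vh n0 by simp
  qed (intro Bochner_Integration.integrable_add integrable_mult_left integrable_mult_right mi Fub(1) q'(1) int_ind)
  also have "\<dots> = u * (1 + r\<^sub>M\<^sup>2 * h\<^sup>2 / 2) + (LINT y|lborel. \<nu> y * D y - \<bar>v 0 y - \<nu> y\<bar> * A y)
      + ((LINT s|lborel. q s) + r\<^sub>M\<^sup>2 * h * h)"
    using mi Fub(1) q' int_ind ind by (simp add: u_def)
  also have "(LINT y|lborel. \<nu> y * D y - \<bar>v 0 y - \<nu> y\<bar> * A y)
      \<le> (LINT s|lborel. (2 * (r\<^sub>M\<^sup>2 * h) - r\<^sub>0 * u) * indicator {0..h} s - q s)"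
    unfolding Fub(3)
  proof (rule integral_mono)
    fix s
    show "indicator {0..h} s * (LINT y|lborel. \<Psi> s y) \<le> (2 * (r\<^sub>M\<^sup>2 * h) - r\<^sub>0 * u) * indicator {0..h} s - q s"
    proof (cases "s \<in> {0..h}")
      case True
      then have s: "0 \<le> s" "s \<le> h" by auto
      have sh: "r\<^sub>M\<^sup>2 * s \<le> r\<^sub>M\<^sup>2 * h" using s by (intro mult_left_mono) auto
      have "\<bar>K s - (LINT y|lborel. \<rho> (y + s) (K s) * v 0 y)\<bar> \<le> r\<^sub>M\<^sup>2 * h"
        using activity_from_earlier_density[OF K s(1) v w[OF s] tr[OF s] act[OF s]] sh by linarith
      moreover have "\<bar>J - (LINT y|lborel. \<rho> (y + s) J * \<nu> y)\<bar> \<le> r\<^sub>M\<^sup>2 * h"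
        using activity_from_earlier_density[of "\<lambda>_. J", OF _ _ s(1) \<nu> \<nu> tr\<nu>[OF s] actJ] J sh by force
      ultimately have "(LINT y|lborel. \<Psi> s y) \<le> 2 * (r\<^sub>M\<^sup>2 * h) - r\<^sub>0 * u - \<bar>K s - J\<bar>"
        unfolding \<Psi>_def u_def by (rule inhibition_cancellation[OF v \<nu>])
      then show ?thesis using True by (simp add: q_def)
    qed (auto simp: q_def)
  qed (use Fub(2) q int_ind in auto)
  also have "\<dots> = (2 * (r\<^sub>M\<^sup>2 * h) - r\<^sub>0 * u) * h - (LINT s|lborel. q s)"
    using q int_ind ind by simp
  finally have "(LINT x|lborel. \<bar>v h x - \<nu> x\<bar>)
     \<le> u * (1 + r\<^sub>M\<^sup>2 * h\<^sup>2 / 2) + (2 * (r\<^sub>M\<^sup>2 * h) - r\<^sub>0 * u) * h + r\<^sub>M\<^sup>2 * h * h" by simp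
  also have "\<dots> = (1 - r\<^sub>0 * h) * u + u / 2 * (r\<^sub>M\<^sup>2 * h\<^sup>2) + 3 * (r\<^sub>M\<^sup>2 * h\<^sup>2)"
    by (simp add: algebra_simps power2_eq_square)
  also have "\<dots> \<le> (1 - r\<^sub>0 * h) * u + 1 * (r\<^sub>M\<^sup>2 * h\<^sup>2) + 3 * (r\<^sub>M\<^sup>2 * h\<^sup>2)"
    using u2 by (intro add_mono mult_right_mono order_refl) auto
  finally show ?thesis by (simp add: u_def algebra_simps)
qed

end

section \<open>From steps to exponential decay\<close>

text \<open>
  The steps are those of the explicit Euler scheme for \<open>u' = - a u\<close>: over \<open>N\<close> steps of length
  \<open>t / N\<close> the errors add up to at most \<open>N \<cdot> C (t / N)\<^sup>2\<close>, which tends to \<open>0\<close>.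
\<close>

lemma exponential_decay_from_steps:
  fixes u :: "real \<Rightarrow> real"
  assumes step: "\<And>t h. 0 \<le> t \<Longrightarrow> 0 \<le> h \<Longrightarrow> u (t + h) \<le> (1 - a * h) * u t + C * h\<^sup>2"
    and a: "0 < a" and C: "0 \<le> C" and u0: "0 \<le> u 0" and t: "0 \<le> t"
  shows "u t \<le> exp (- a * t) * u 0"
proof -
  have bound: "u t \<le> exp (- a * t) * u 0 + C * t\<^sup>2 / real N" if N: "N > 0" "a * t \<le> real N" for N
  proof -
    define h where "h = t / real N"
    have h: "0 \<le> h" "a * h \<le> 1" "real N * h = t"
      using N t by (auto simp: h_def)
    have "u (real k * h) \<le> (1 - a * h) ^ k * u 0 + real k * (C * h\<^sup>2)" for k
    proof (induction k)
      case (Suc k)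
      have "u (real (Suc k) * h) = u (real k * h + h)" by (simp add: algebra_simps)
      also have "\<dots> \<le> (1 - a * h) * u (real k * h) + C * h\<^sup>2"
        using h by (intro step) auto
      also have "\<dots> \<le> (1 - a * h) * ((1 - a * h) ^ k * u 0 + real k * (C * h\<^sup>2)) + C * h\<^sup>2"
        using Suc h by (intro add_right_mono mult_left_mono) auto
      also have "(1 - a * h) * ((1 - a * h) ^ k * u 0 + real k * (C * h\<^sup>2))
          \<le> (1 - a * h) ^ Suc k * u 0 + 1 * (real k * (C * h\<^sup>2))"
        unfolding distrib_left using h a C by (intro add_mono mult_right_mono) auto
      finally show ?case by (simp add: algebra_simps)
    qed simp
    from this[of N] have "u t \<le> (1 - a * h) ^ N * u 0 + real N * (C * h\<^sup>2)"
      using h by simp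
    also have "(1 - a * h) ^ N \<le> exp (- (a * h)) ^ N"
      using h exp_ge_add_one_self[of "- (a * h)"] by (intro power_mono) auto
    also have "exp (- (a * h)) ^ N = exp (- a * t)"
      using h(3) by (simp flip: exp_of_nat_mult)
    also have "real N * (C * h\<^sup>2) = C * t\<^sup>2 / real N"
      using N by (simp add: h_def power2_eq_square field_simps)
    finally show ?thesis using u0 by (simp add: mult_right_mono)
  qed
  have "(\<lambda>N. exp (- a * t) * u 0 + C * t\<^sup>2 / real N) \<longlonglongrightarrow> exp (- a * t) * u 0 + 0"
    by (intro tendsto_intros lim_const_over_n)
  moreover have "\<forall>\<^sub>F N in sequentially. u t \<le> exp (- a * t) * u 0 + C * t\<^sup>2 / real N"
  proof -
    have "\<forall>\<^sub>F N in sequentially. real N \<ge> a * t"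
      using filterlim_real_sequentially by (simp add: filterlim_at_top)
    with eventually_gt_at_top[of 0] show ?thesis
      by eventually_elim (rule bound)
  qed
  ultimately have "u t \<le> exp (- a * t) * u 0 + 0"
    by (intro tendsto_lowerbound) auto
  then show ?thesis by simp
qed

section \<open>Solutions and steady states for the given rate\<close>

locale regularised_rate = firing_rate +
  fixes r :: "real \<Rightarrow> real \<Rightarrow> real"
  assumes rate_measurable_age: "J \<in> {0..r\<^sub>M} \<Longrightarrow> (\<lambda>x. r x J) \<in> borel_measurable half_line"
    and rate_eq: "AE x in lborel. 0 < x \<longrightarrow> (\<forall>J\<in>{0..r\<^sub>M}. r x J = \<rho> x J)"
begin

lemma borel_density:
  assumes f: "integrable half_line f" "AE x in half_line. 0 \<le> f x" "(LINT x|half_line. f x) = 1"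
  obtains v where "density v" "AE x in lborel. 0 < x \<longrightarrow> f x = v x"
proof -
  have "(\<lambda>x. indicator {0<..} x *\<^sub>R f x) \<in> borel_measurable lebesgue"
    using f(1) by (auto simp: integrable_restrict_space)
  then obtain g where g: "g \<in> borel_measurable lborel" "AE x in lborel. indicator {0<..} x *\<^sub>R f x = g x"
    using completion_ex_borel_measurable_real by blast
  define v where "v x = (if x \<le> 0 then 0 else max 0 (g x))" for x
  have [measurable]: "g \<in> borel_measurable borel" using g(1) by simp
  have vm: "v \<in> borel_measurable borel" unfolding v_def by measurable
  have ae: "AE x in lborel. 0 < x \<longrightarrow> f x = v x"
    using g(2) f(2)[unfolded AE_half_line_iff] by eventually_elim (auto simp: v_def)
  have v0: "\<And>x. x \<le> 0 \<Longrightarrow> v x = 0" by (simp add: v_def)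
  have "\<And>x. 0 \<le> v x" by (simp add: v_def)
  then have "density v"
    using half_line_integral[OF borel_measurable_integrable[OF f(1)] vm v0 ae] f v0
    by (simp add: density_def)
  then show thesis using ae by (rule that)
qed

lemma rate_integral:
  assumes J: "J \<in> {0..r\<^sub>M}" and f: "f \<in> borel_measurable half_line"
    and v: "integrable lborel v" "\<And>x. x \<le> 0 \<Longrightarrow> v x = 0" "AE x in lborel. 0 < x \<longrightarrow> f x = v x"
  shows "(LINT x|half_line. r x J * f x) = (LINT x|lborel. \<rho> x J * v x)"
proof (rule half_line_integral)
  show "(\<lambda>x. r x J * f x) \<in> borel_measurable half_line"
    using rate_measurable_age[OF J] f by (rule borel_measurable_times)
  have "integrable lborel (\<lambda>x. \<rho> x J * v x)"
    by (intro integrable_rate_mult v) measurable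
  then show "(\<lambda>x. \<rho> x J * v x) \<in> borel_measurable borel"
    using borel_measurable_integrable by fastforce
  show "AE x in lborel. 0 < x \<longrightarrow> r x J * f x = \<rho> x J * v x"
    using rate_eq v(3) by eventually_elim (use J in auto)
qed (use v in auto)

text \<open>
  A characteristic meets each age once, so an exceptional null set of ages is met at a null set of
  times. The maximum extends the activity to negative times continuously.
\<close>

lemma hazard_along_characteristic:
  assumes I: "continuous_on {0..} I" "\<And>t. 0 \<le> t \<Longrightarrow> I t \<in> {0..r\<^sub>M}" and "0 \<le> x" "0 \<le> \<tau>"
  shows "(LINT s|lebesgue_on {0..t}. r (x + s) (I (\<tau> + s)))
       = primitive (\<lambda>s. \<rho> (x + s) (I (max 0 (\<tau> + s)))) t"
proof (rule lebesgue_integral_eq_primitive[OF _ rate_abs])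
  have "continuous_on UNIV (\<lambda>s. I (max 0 (\<tau> + s)))"
    by (rule continuous_on_compose2[OF I(1)]) (auto intro!: continuous_intros)
  then have [measurable]: "(\<lambda>s. I (max 0 (\<tau> + s))) \<in> borel_measurable borel"
    by (rule borel_measurable_continuous_onI)
  show "(\<lambda>s. \<rho> (x + s) (I (max 0 (\<tau> + s)))) \<in> borel_measurable borel"
    by measurable
  show "AE s in lborel. 0 < s \<and> s < t \<longrightarrow> r (x + s) (I (\<tau> + s)) = \<rho> (x + s) (I (max 0 (\<tau> + s)))"
    using AE_lborel_shift[OF rate_eq, of x]
    by eventually_elim (use I(2) assms in \<open>auto simp: add.commute max_def\<close>)
qed

text \<open>
  The solution formula has the flow property: following a characteristic up to time \<open>t\<close> and then
  for a further time \<open>h\<close> splits the accumulated hazard, whether the characteristic starts from the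
  initial density or from the boundary.
\<close>

lemma solution_transported:
  assumes I: "continuous_on {0..} I" "\<And>t. 0 \<le> t \<Longrightarrow> I t \<in> {0..r\<^sub>M}"
    and char: "\<And>t. 0 \<le> t \<Longrightarrow> AE x in lborel. 0 < x \<longrightarrow>
        v t x = (if t \<le> x
                 then n_ini (x - t) * exp (- (LINT s|lebesgue_on {0..t}. r (x - t + s) (I s)))
                 else I (t - x) * exp (- (LINT s|lebesgue_on {0..x}. r s (I (t - x + s)))))"
    and t: "0 \<le> t" and h: "0 \<le> h"
  shows "transported (\<lambda>s. I (max 0 (t + s))) h (v t) (v (t + h))"
proof -
  define I' where "I' s = I (max 0 s)" for s
  have "continuous_on UNIV I'"
    unfolding I'_def by (rule continuous_on_compose2[OF I(1)]) (auto intro!: continuous_intros)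
  then have [measurable]: "I' \<in> borel_measurable borel"
    by (rule borel_measurable_continuous_onI)
  define \<Phi> where "\<Phi> t x = (if t \<le> x
                 then n_ini (x - t) * exp (- primitive (\<lambda>s. \<rho> (x - t + s) (I' s)) t)
                 else I' (t - x) * exp (- primitive (\<lambda>s. \<rho> s (I' (t - x + s))) x))" for t x
  have char': "AE x in lborel. 0 < x \<longrightarrow> v t x = \<Phi> t x" if "0 \<le> t" for t
    using char[OF that]
  proof eventually_elim
    case (elim x)
    show ?case
    proof
      assume x: "0 < x"
      show "v t x = \<Phi> t x"
      proof (cases "t \<le> x")
        case True
        then show ?thesis
          using elim x hazard_along_characteristic[OF I, of "x - t" 0 t] by (simp add: \<Phi>_def I'_def)
      next
        case False
        then show ?thesis
          using elim x hazard_along_characteristic[OF I, of 0 "t - x" x] by (simp add: \<Phi>_def I'_def)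
      qed
    qed
  qed
  have flow: "\<Phi> (t + h) (y + h) = \<Phi> t y * exp (- primitive (\<lambda>s. \<rho> (y + s) (I' (t + s))) h)"
    if y: "0 < y" for y
  proof (cases "t \<le> y")
    case True
    have m: "(\<lambda>s. \<rho> (y - t + s) (I' s)) \<in> borel_measurable borel" by measurable
    have "primitive (\<lambda>s. \<rho> (y - t + s) (I' s)) (t + h)
        = primitive (\<lambda>s. \<rho> (y - t + s) (I' s)) t + primitive (\<lambda>s. \<rho> (y + s) (I' (t + s))) h"
      using primitive_add[OF m rate_abs t h] by (simp add: algebra_simps)
    then show ?thesis using True by (simp add: \<Phi>_def exp_diff exp_minus field_simps)
  next
    case False
    have m: "(\<lambda>s. \<rho> s (I' (t - y + s))) \<in> borel_measurable borel" by measurable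
    have "primitive (\<lambda>s. \<rho> s (I' (t - y + s))) (y + h)
        = primitive (\<lambda>s. \<rho> s (I' (t - y + s))) y + primitive (\<lambda>s. \<rho> (y + s) (I' (t + s))) h"
      using primitive_add[OF m rate_abs _ h, of y] y by (simp add: algebra_simps)
    then show ?thesis using False by (simp add: \<Phi>_def exp_diff exp_minus field_simps)
  qed
  have 1: "AE y in lborel. 0 < y \<longrightarrow> v (t + h) (y + h) = v t y * exp (- primitive (\<lambda>s. \<rho> (y + s) (I' (t + s))) h)"
    using AE_lborel_shift[OF char'[of "t + h"], of h] char'[OF t] t h
    by (auto elim!: eventually_elim2 simp: flow)
  have 2: "AE x in lborel. 0 < x \<and> x < h \<longrightarrow>
        v (t + h) x = I' (t + (h - x)) * exp (- primitive (\<lambda>s. \<rho> s (I' (t + (h - x + s)))) x)"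
    using char'[of "t + h"] t h
    by (auto elim!: eventually_mono simp: \<Phi>_def algebra_simps)
  from 1 2 show ?thesis
    unfolding transported_def I'_def by blast
qed

text \<open>
  The steady state \<open>J \<cdot> survival J\<close>, cut off at the nonpositive ages as \<open>density\<close> demands.
\<close>

definition steady_density :: "real \<Rightarrow> real \<Rightarrow> real" where
  "steady_density J x = (if x \<le> 0 then 0 else J * survival J x)"

lemma steady_density_integral:
  "integrable lborel (steady_density J)" "(LINT x|lborel. steady_density J x) = J * lifetime J"
  "(LINT x|lborel. \<rho> x J * steady_density J x) = J"
proof -
  have ae: "AE x in lborel. x \<noteq> (0::real)" by (rule AE_lborel_singleton)
  have m: "steady_density J \<in> borel_measurable lborel" unfolding steady_density_def by measurable
  have i: "integrable lborel (\<lambda>x. indicator {0..} x *\<^sub>R survival J x)"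
    "integrable lborel (\<lambda>x. indicator {0..} x *\<^sub>R (\<rho> x J * survival J x))"
    using survival_integrable[of J] rate_survival_integral(1)[of J] by (auto simp: set_integrable_def)
  have e1: "AE x in lborel. J * (indicator {0..} x *\<^sub>R survival J x) = steady_density J x"
    using ae by eventually_elim (auto simp: steady_density_def indicator_def)
  have e2: "AE x in lborel. \<rho> x J * steady_density J x = J * (indicator {0..} x *\<^sub>R (\<rho> x J * survival J x))"
    using ae by eventually_elim (auto simp: steady_density_def indicator_def)
  show "integrable lborel (steady_density J)"
    by (rule integrable_cong_AE_imp[OF integrable_mult_right[OF i(1)] m e1])
  have "(LINT x|lborel. steady_density J x) = (LINT x|lborel. J * (indicator {0..} x *\<^sub>R survival J x))"
    using e1 m i by (intro integral_cong_AE) (auto elim!: eventually_mono)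
  then show "(LINT x|lborel. steady_density J x) = J * lifetime J"
    by (simp add: lifetime_def set_lebesgue_integral_def)
  have "(LINT x|lborel. \<rho> x J * steady_density J x) = (LINT x|lborel. J * (indicator {0..} x *\<^sub>R (\<rho> x J * survival J x)))"
    using e2 m i by (intro integral_cong_AE) auto
  then show "(LINT x|lborel. \<rho> x J * steady_density J x) = J"
    using rate_survival_integral(2)[of J] by (simp add: set_lebesgue_integral_def)
qed

lemma steady_density_transported:
  assumes "0 \<le> h"
  shows "transported (\<lambda>_. J) h (steady_density J) (steady_density J)"
proof -
  have m: "(\<lambda>s. \<rho> s J) \<in> borel_measurable borel" by measurable
  have "survival J (y + h) = survival J y * exp (- primitive (\<lambda>s. \<rho> (y + s) J) h)" if "0 < y" for y
    using primitive_add[OF m rate_abs _ assms, of y] that by (simp add: survival_def flip: exp_add)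
  then show ?thesis
    using assms unfolding transported_def
    by (auto intro!: AE_I2 simp: steady_density_def survival_def)
qed

lemma steady_density_density:
  assumes "0 \<le> J" "J * lifetime J = 1"
  shows "density (steady_density J)"
  using steady_density_integral(1,2)[of J] assms
  by (auto simp: density_def steady_density_def survival_nonneg)

lemma is_steady_state_survival:
  assumes J: "0 \<le> J" "J \<le> r\<^sub>M" "J * lifetime J = 1"
  shows "is_steady_state r\<^sub>M r (\<lambda>x. J * survival J x) J"
proof -
  have JR: "J \<in> {0..r\<^sub>M}" using J by simp
  have m: "(\<lambda>x. J * survival J x) \<in> borel_measurable half_line"
    by (intro measurable_restrict_space1 measurable_completion) measurable
  have vm: "steady_density J \<in> borel_measurable borel"
    using borel_measurable_integrable[OF steady_density_integral(1)] by simp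
  have v0: "\<And>x. x \<le> 0 \<Longrightarrow> steady_density J x = 0" by (simp add: steady_density_def)
  have eq: "AE x in lborel. 0 < x \<longrightarrow> J * survival J x = steady_density J x"
    by (intro AE_I2) (simp add: steady_density_def)
  have AC: "absolutely_continuous_on 0 b (\<lambda>x. J * survival J x)" for b
    by (rule AC_mult[OF Lipschitz_imp_AC[where L = 0] survival_AC]) simp
  have ode: "AE x in half_line. \<exists>d. ((\<lambda>x. J * survival J x) has_real_derivative d) (at x) \<and>
       d + r x J * (J * survival J x) = 0"
    unfolding AE_half_line_iff using survival_has_derivative[of J] rate_eq
  proof eventually_elim
    case (elim x)
    show ?case
    proof
      assume x: "0 < x"
      then have "((\<lambda>x. J * survival J x) has_real_derivative J * (- \<rho> x J * survival J x)) (at x)"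
        using elim by (intro DERIV_cmult) auto
      then show "\<exists>d. ((\<lambda>x. J * survival J x) has_real_derivative d) (at x) \<and> d + r x J * (J * survival J x) = 0"
        using elim x JR by (intro exI[of _ "J * (- \<rho> x J * survival J x)"]) auto
    qed
  qed
  have act: "(LINT x|half_line. r x J * (J * survival J x)) = J"
    using rate_integral[OF JR m steady_density_integral(1) v0 eq] steady_density_integral(3) by simp
  show ?thesis
    unfolding is_steady_state_def
    using JR AC ode act half_line_integral[OF m vm v0 eq] steady_density_integral[of J] J
    by (auto simp: survival_0 survival_nonneg)
qed

text \<open>
  Any steady state is determined by its activity \<open>K\<close>, and its unit mass pins \<open>K\<close> down.
\<close>

lemma steady_state_is_survival:
  assumes st: "is_steady_state r\<^sub>M r \<mu> K"
  shows "0 \<le> K" "K * lifetime K = 1" "\<And>x. 0 \<le> x \<Longrightarrow> \<mu> x = K * survival K x"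
proof -
  have K: "K \<in> {0..r\<^sub>M}" and ode: "AE x in half_line. \<exists>d. (\<mu> has_real_derivative d) (at x) \<and> d + r x K * \<mu> x = 0"
    and mu: "\<mu> 0 = K" "\<And>b. b > 0 \<Longrightarrow> absolutely_continuous_on 0 b \<mu>" "integrable half_line \<mu>" "(LINT x|half_line. \<mu> x) = 1"
    using st unfolding is_steady_state_def by auto
  show "0 \<le> K" using K by simp
  have "AE x in lborel. 0 < x \<longrightarrow> (\<exists>d. (\<mu> has_real_derivative d) (at x) \<and> d + \<rho> x K * \<mu> x = 0)"
    using ode[unfolded AE_half_line_iff] rate_eq by eventually_elim (use K in auto)
  then show eq: "\<mu> x = K * survival K x" if "0 \<le> x" for x
    using ODE_solution_is_survival[of \<mu> K x] mu(1,2) that by simp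
  have vm: "steady_density K \<in> borel_measurable borel"
    using borel_measurable_integrable[OF steady_density_integral(1)] by simp
  have "(LINT x|half_line. \<mu> x) = (LINT x|lborel. steady_density K x)"
    by (rule half_line_integral(1)[OF borel_measurable_integrable[OF mu(3)] vm])
       (auto simp: steady_density_def eq)
  then show "K * lifetime K = 1"
    using mu(4) steady_density_integral(2)[of K] by simp
qed

text \<open>
  The solution seen from time \<open>t\<close> on, in Borel versions, meets the hypotheses of
  \<open>one_step_contraction\<close>; the steady state does so with constant activity.
\<close>

lemma solution_contracts_to_steady_state:
  assumes J: "0 \<le> J" "J \<le> r\<^sub>M" "J * lifetime J = 1"
    and sol: "is_solution r\<^sub>M r n_ini n I" and t: "0 \<le> t"
  shows "L1_norm (\<lambda>x. n t x - J * survival J x) \<le> exp (- r\<^sub>0 * t) * L1_norm (\<lambda>x. n 0 x - J * survival J x)"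
proof -
  have I: "continuous_on {0..} I" "\<And>t. 0 \<le> t \<Longrightarrow> I t \<in> {0..r\<^sub>M}"
    and n: "\<And>t. 0 \<le> t \<Longrightarrow> integrable half_line (n t)" "\<And>t. 0 \<le> t \<Longrightarrow> AE x in half_line. 0 \<le> n t x"
      "\<And>t. 0 \<le> t \<Longrightarrow> (LINT x|half_line. n t x) = 1"
    and act: "\<And>t. 0 \<le> t \<Longrightarrow> I t = (LINT x|half_line. r x (I t) * n t x)"
    and char: "\<And>t. 0 \<le> t \<Longrightarrow> AE x in half_line.
        n t x = (if t \<le> x
                 then n_ini (x - t) * exp (- (LINT s|lebesgue_on {0..t}. r (x - t + s) (I s)))
                 else I (t - x) * exp (- (LINT s|lebesgue_on {0..x}. r s (I (t - x + s)))))"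
    using sol unfolding is_solution_def by auto
  have "\<forall>t. \<exists>v. 0 \<le> t \<longrightarrow> density v \<and> (AE x in lborel. 0 < x \<longrightarrow> n t x = v x)"
  proof
    fix t
    show "\<exists>v. 0 \<le> t \<longrightarrow> density v \<and> (AE x in lborel. 0 < x \<longrightarrow> n t x = v x)"
    proof (cases "0 \<le> t")
      case True
      from borel_density[OF n[OF this]] show ?thesis by blast
    qed auto
  qed
  then obtain v where v: "\<And>t. 0 \<le> t \<Longrightarrow> density (v t)" "\<And>t. 0 \<le> t \<Longrightarrow> AE x in lborel. 0 < x \<longrightarrow> n t x = v t x"
    using choice[of "\<lambda>t v. 0 \<le> t \<longrightarrow> density v \<and> (AE x in lborel. 0 < x \<longrightarrow> n t x = v x)"] by blast
  define \<nu> where "\<nu> = steady_density J"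
  define u where "u t = (LINT x|lborel. \<bar>v t x - \<nu> x\<bar>)" for t
  have \<nu>: "density \<nu>" unfolding \<nu>_def using J by (intro steady_density_density)
  have norm: "L1_norm (\<lambda>x. n t x - J * survival J x) = u t" if "0 \<le> t" for t
    unfolding L1_norm_def u_def
  proof (rule half_line_integral(1))
    have "(\<lambda>x. J * survival J x) \<in> borel_measurable half_line"
      by (intro measurable_restrict_space1 measurable_completion) measurable
    then show "(\<lambda>x. \<bar>n t x - J * survival J x\<bar>) \<in> borel_measurable half_line"
      using borel_measurable_integrable[OF n(1)[OF that]] by measurable
    have [measurable]: "v t \<in> borel_measurable borel" "\<nu> \<in> borel_measurable borel"
      using v(1)[OF that] \<nu> by (auto simp: density_def dest!: borel_measurable_integrable)
    show "(\<lambda>x. \<bar>v t x - \<nu> x\<bar>) \<in> borel_measurable borel"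
      by measurable
    show "\<bar>v t x - \<nu> x\<bar> = 0" if "x \<le> 0" for x
      using v(1)[OF \<open>0 \<le> t\<close>] \<nu> that by (simp add: density_def)
    show "AE x in lborel. 0 < x \<longrightarrow> \<bar>n t x - J * survival J x\<bar> = \<bar>v t x - \<nu> x\<bar>"
      using v(2)[OF that] by eventually_elim (simp add: \<nu>_def steady_density_def)
  qed
  have char': "AE x in lborel. 0 < x \<longrightarrow>
        v t x = (if t \<le> x
                 then n_ini (x - t) * exp (- (LINT s|lebesgue_on {0..t}. r (x - t + s) (I s)))
                 else I (t - x) * exp (- (LINT s|lebesgue_on {0..x}. r s (I (t - x + s)))))" if "0 \<le> t" for t
    using char[OF that, unfolded AE_half_line_iff] v(2)[OF that] by eventually_elim auto
  have "u (t + h) \<le> (1 - r\<^sub>0 * h) * u t + (4 * r\<^sub>M\<^sup>2) * h\<^sup>2" if th: "0 \<le> t" "0 \<le> h" for t h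
  proof -
    define K where "K s = I (max 0 (t + s))" for s
    have "continuous_on UNIV K"
      unfolding K_def by (rule continuous_on_compose2[OF I(1)]) (auto intro!: continuous_intros)
    then have K1: "K \<in> borel_measurable borel"
      by (rule borel_measurable_continuous_onI)
    have K2: "0 \<le> K s \<and> K s \<le> r\<^sub>M" for s
      using I(2)[of "max 0 (t + s)"] by (simp add: K_def)
    have actK: "K s = (LINT x|lborel. \<rho> x (K s) * v (t + s) x)" if "0 \<le> s" for s
    proof -
      have ts: "0 \<le> t + s" using th that by simp
      have "K s = I (t + s)" using ts by (simp add: K_def)
      moreover have "(LINT x|half_line. r x (I (t + s)) * n (t + s) x) = (LINT x|lborel. \<rho> x (I (t + s)) * v (t + s) x)"
        using v(1)[OF ts] n(1)[OF ts]
        by (intro rate_integral I(2) v(2) ts) (auto simp: density_def)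
      ultimately show ?thesis using act[OF ts] by simp
    qed
    have "(LINT x|lborel. \<bar>v (t + h) x - \<nu> x\<bar>)
        \<le> (1 - r\<^sub>0 * h) * (LINT x|lborel. \<bar>v (t + 0) x - \<nu> x\<bar>) + 4 * r\<^sub>M\<^sup>2 * h\<^sup>2"
    proof (rule one_step_contraction[where v = "\<lambda>s. v (t + s)", OF K1 K2 J(1,2) th(2)])
      show "density (v (t + 0))" "density \<nu>" "\<And>s. 0 \<le> s \<Longrightarrow> density (v (t + s))"
        using v(1) \<nu> th by auto
      show "transported K s (v (t + 0)) (v (t + s))" if "0 \<le> s" for s
        using solution_transported[of I v n_ini, OF I char' th(1) that] by (simp add: K_def[abs_def])
      show "transported (\<lambda>_. J) s \<nu> \<nu>" if "0 \<le> s" for s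
        unfolding \<nu>_def using that by (rule steady_density_transported)
      show "J = (LINT x|lborel. \<rho> x J * \<nu> x)"
        unfolding \<nu>_def by (rule steady_density_integral(3)[symmetric])
    qed (rule actK)
    then show ?thesis by (simp add: u_def)
  qed
  then have "u t \<le> exp (- r\<^sub>0 * t) * u 0"
    using exponential_decay_from_steps[of u r\<^sub>0 "4 * r\<^sub>M\<^sup>2" t] rate_lower_pos t
    by (simp add: u_def)
  then show ?thesis using norm[OF t] norm[of 0] by simp
qed

end

theorem theorem1p1:
  fixes r\<^sub>M r\<^sub>0 :: real
    and r dr :: "real \<Rightarrow> real \<Rightarrow> real"
    and n_ini :: "real \<Rightarrow> real"
  assumes "r\<^sub>M > 0"
    and "\<And>J. J \<in> {0..r\<^sub>M} \<Longrightarrow> (\<lambda>x. r x J) \<in> borel_measurable half_line"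
    and "\<And>x J. x > 0 \<Longrightarrow> J \<in> {0..r\<^sub>M} \<Longrightarrow> 0 \<le> r x J \<and> r x J \<le> r\<^sub>M"
    and "\<And>x J. x > 0 \<Longrightarrow> J \<in> {0..r\<^sub>M} \<Longrightarrow>
           ((\<lambda>K. r x K) has_real_derivative dr x J) (at J within {0..r\<^sub>M})"
    and "in_L_infinity ({0<..} \<times> {0<..<r\<^sub>M}) (\<lambda>(x, J). dr x J)"
    and "\<And>x J. x > 0 \<Longrightarrow> J \<in> {0..r\<^sub>M} \<Longrightarrow> dr x J \<le> 0"
    and "r\<^sub>0 > 0"
    and "\<And>x J. x > 0 \<Longrightarrow> J \<in> {0..r\<^sub>M} \<Longrightarrow> r x J \<ge> r\<^sub>0"
    and "integrable half_line n_ini"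
    and "AE x in half_line. n_ini x \<ge> 0"
    and "(LINT x|half_line. n_ini x) = 1"
  shows "\<exists>\<nu> J. is_steady_state r\<^sub>M r \<nu> J \<and>
           (\<forall>\<mu> K. is_steady_state r\<^sub>M r \<mu> K \<longrightarrow> K = J \<and> (\<forall>x\<ge>0. \<mu> x = \<nu> x)) \<and>
           (\<forall>n I. is_solution r\<^sub>M r n_ini n I \<longrightarrow>
              (\<exists>C>0. \<exists>\<kappa>>0. \<forall>t\<ge>0. L1_norm (\<lambda>x. n t x - \<nu> x) \<le> C * exp (- \<kappa> * t)))"
proof -
  define clip where "clip J = max 0 (min r\<^sub>M J)" for J
  have clip: "clip J \<in> {0..r\<^sub>M}" for J using assms(1) by (auto simp: clip_def)
  have cont: "continuous_on {0..r\<^sub>M} (r x)" if "x > 0" for x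
    using assms(4)[OF that] by (rule DERIV_continuous_on)
  have "0 \<le> r\<^sub>M" using assms(1) by simp
  obtain \<rho> N where "N \<in> null_sets lborel" "case_prod \<rho> \<in> borel_measurable borel"
    "\<And>x J. \<rho> x J = (if x \<in> N \<or> x \<le> 0 then r\<^sub>M else r x (max 0 (min r\<^sub>M J)))"
    by (rule Caratheodory_borel_version[where c = r\<^sub>M, OF \<open>0 \<le> r\<^sub>M\<close> assms(2) cont]) (assumption, assumption, rule that)
  note \<rho> = this[folded clip_def]
  have r0M: "r\<^sub>0 \<le> r\<^sub>M"
    using assms(3,8)[of 1 "r\<^sub>M"] assms(1) by auto
  interpret regularised_rate \<rho> r\<^sub>0 r\<^sub>M r
  proof
    show "case_prod \<rho> \<in> borel_measurable borel" "0 < r\<^sub>0" by fact+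
    show "r\<^sub>0 \<le> \<rho> x J" "\<rho> x J \<le> r\<^sub>M" for x J
      using assms(3,8)[OF _ clip, of x J] r0M by (auto simp: \<rho>(3))
    show "\<rho> x K \<le> \<rho> x J" if "J \<le> K" for x J K
    proof (cases "x \<in> N \<or> x \<le> 0")
      case False
      have "r x (clip K) \<le> r x (clip J)"
        using False that clip[of J] clip[of K]
        by (intro nonincreasing_on_Icc[OF assms(4) assms(6)]) (auto simp: clip_def)
      then show ?thesis using False by (simp add: \<rho>(3))
    qed (simp add: \<rho>(3))
    show "isCont (\<rho> x) J" for x J
    proof (cases "x \<in> N \<or> x \<le> 0")
      case False
      then have "continuous_on UNIV (\<lambda>J. r x (clip J))"
        using clip by (intro continuous_on_compose2[OF cont[of x]]) (auto simp: clip_def intro!: continuous_intros)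
      then show ?thesis using False by (simp add: \<rho>(3)[abs_def] continuous_on_eq_continuous_at)
    qed (simp add: \<rho>(3)[abs_def])
    show "(\<lambda>x. r x J) \<in> borel_measurable half_line" if "J \<in> {0..r\<^sub>M}" for J
      using that by (rule assms(2))
    have "AE x in lborel. x \<notin> N" using \<rho>(1) by (rule AE_not_in)
    then show "AE x in lborel. 0 < x \<longrightarrow> (\<forall>J\<in>{0..r\<^sub>M}. r x J = \<rho> x J)"
      by eventually_elim (auto simp: \<rho>(3) clip_def)
  qed
  obtain J where J: "0 < J" "J \<le> r\<^sub>M" "J * lifetime J = 1"
    "\<forall>K\<ge>0. K * lifetime K = 1 \<longrightarrow> K = J"
    by (rule equilibrium_activity)
  show ?thesis
  proof (rule exI[of _ "\<lambda>x. J * survival J x"], rule exI[of _ J], intro conjI allI impI)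
    show "is_steady_state r\<^sub>M r (\<lambda>x. J * survival J x) J"
      using J by (intro is_steady_state_survival) auto
    fix \<mu> K assume st: "is_steady_state r\<^sub>M r \<mu> K"
    show KJ: "K = J"
      using steady_state_is_survival(1,2)[OF st] J(4) by blast
    show "\<mu> x = J * survival J x" if "0 \<le> x" for x
      using steady_state_is_survival(3)[OF st that] KJ by simp
  next
    fix n I assume sol: "is_solution r\<^sub>M r n_ini n I"
    define D where "D = L1_norm (\<lambda>x. n 0 x - J * survival J x)"
    have D: "0 \<le> D" by (simp add: D_def L1_norm_def)
    have "L1_norm (\<lambda>x. n t x - J * survival J x) \<le> (D + 1) * exp (- r\<^sub>0 * t)" if "0 \<le> t" for t
    proof -
      have "L1_norm (\<lambda>x. n t x - J * survival J x) \<le> exp (- r\<^sub>0 * t) * D"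
        unfolding D_def using J by (intro solution_contracts_to_steady_state[OF _ _ _ sol that]) auto
      also have "\<dots> \<le> (D + 1) * exp (- r\<^sub>0 * t)" by (simp add: algebra_simps)
      finally show ?thesis .
    qed
    then show "\<exists>C>0. \<exists>\<kappa>>0. \<forall>t\<ge>0. L1_norm (\<lambda>x. n t x - J * survival J x) \<le> C * exp (- \<kappa> * t)"
      using D assms(7) by (intro exI[of _ "D + 1"] conjI exI[of _ r\<^sub>0]) auto
  qed
qed

end
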